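(* Let $I=(-1,1)$, $\beta>0$, $y_d\in L_2(I)$, $f\in H^1(I)$, and let $\psi\in H^2(I)$ satisfy $\int_I\psi\,dx>0$. Let $(\bar y,\bar u)$ be the solution of the optimal control problem $$(\bar y,\bar u)=\mathop{\rm argmin}_{(y,u)\in\mathbb{K}}\frac12\big(\|y-y_d\|_{L_2(I)}^2+\beta\|u\|_{L_2(I)}^2\big),$$ where $\mathbb{K}$ is the set of all $(y,u)\in H^1_0(I)\times L_2(I)$ such that $$\int_I y'z'\,dx=\int_I(u+f)z\,dx\quad\forall\,z\in H^1_0(I)\qquad\text{and}\qquad y'\leq\psi\quad\text{a.e. on } I.$$ Then $(\bar y,\bar u)$ belongs to $H^3(I)\times H^1(I)$.
   Context: $H^k(I)$ and $H^1_0(I)$ are the usual real-valued $L_2$-based Sobolev spaces. The optimal control problem has a unique solution: the equation constraint forces $y\in H^2(I)$ with $u=-(y''+f)$, so the problem is equivalent to minimizing $\frac12(\|y-y_d\|_{L_2(I)}^2+\beta\|y''+f\|_{L_2(I)}^2)$ over the nonempty closed convex set $K=\{y\in H^2(I)\cap H^1_0(I): y'\leq\psi \text{ on } I\}$, with $\bar u=-(\bar y''+f)$. *)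

theory Defs
  imports "HOL-Analysis.Analysis"
begin

text \<open>
  Elements of $L_2$ and of the Sobolev spaces are represented by functions on the whole real line,
  of which only the restriction to the set \<^term>\<open>S\<close> matters.  Functions that agree almost
  everywhere on \<^term>\<open>S\<close> are not identified; all notions below except
  \<open>test_functions\<close> are invariant under such changes.
\<close>

definition L2_space :: "real set \<Rightarrow> (real \<Rightarrow> real) set"
  where "L2_space S =
    {u. u \<in> borel_measurable (lebesgue_on S) \<and> integrable (lebesgue_on S) (\<lambda>x. (u x)\<^sup>2)}"

definition L2_norm :: "real set \<Rightarrow> (real \<Rightarrow> real) \<Rightarrow> real"
  where "L2_norm S u = sqrt (LINT x|lebesgue_on S. (u x)\<^sup>2)"

definition test_functions :: "real set \<Rightarrow> (real \<Rightarrow> real) set"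
  where "test_functions S =
    {\<phi>. (\<forall>n. (deriv ^^ n) \<phi> differentiable_on UNIV) \<and>
        compact (closure {x. \<phi> x \<noteq> 0}) \<and> closure {x. \<phi> x \<noteq> 0} \<subseteq> S}"

definition has_weak_deriv :: "nat \<Rightarrow> real set \<Rightarrow> (real \<Rightarrow> real) \<Rightarrow> (real \<Rightarrow> real) \<Rightarrow> bool"
  where "has_weak_deriv k S u g \<longleftrightarrow>
    u \<in> L2_space S \<and> g \<in> L2_space S \<and>
    (\<forall>\<phi>\<in>test_functions S.
      (LINT x|lebesgue_on S. u x * (deriv ^^ k) \<phi> x) =
      (-1) ^ k * (LINT x|lebesgue_on S. g x * \<phi> x))"

definition Sobolev_space :: "nat \<Rightarrow> real set \<Rightarrow> (real \<Rightarrow> real) set"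
  where "Sobolev_space k S = {u. \<forall>j\<le>k. \<exists>g. has_weak_deriv j S u g}"

text \<open>
  A representative of the first weak derivative: on open sets it is unique up to null sets, and it
  exists (hence is meaningful) for elements of \<open>Sobolev_space 1 S\<close>.
\<close>

definition weak_deriv :: "real set \<Rightarrow> (real \<Rightarrow> real) \<Rightarrow> real \<Rightarrow> real"
  where "weak_deriv S u = (SOME g. has_weak_deriv 1 S u g)"

definition H1_norm :: "real set \<Rightarrow> (real \<Rightarrow> real) \<Rightarrow> real"
  where "H1_norm S u = sqrt ((L2_norm S u)\<^sup>2 + (L2_norm S (weak_deriv S u))\<^sup>2)"

definition H10_space :: "real set \<Rightarrow> (real \<Rightarrow> real) set"
  where "H10_space S =
    {u \<in> Sobolev_space 1 S.
      \<exists>\<phi>. (\<forall>n::nat. \<phi> n \<in> test_functions S) \<and> (\<lambda>n. H1_norm S (\<lambda>x. u x - \<phi> n x)) \<longlonglongrightarrow> 0}"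

definition admissible ::
    "real set \<Rightarrow> (real \<Rightarrow> real) \<Rightarrow> (real \<Rightarrow> real) \<Rightarrow> ((real \<Rightarrow> real) \<times> (real \<Rightarrow> real)) set"
  where "admissible S f \<psi> =
    {(y, u). y \<in> H10_space S \<and> u \<in> L2_space S \<and>
      (\<forall>z\<in>H10_space S.
        (LINT x|lebesgue_on S. weak_deriv S y x * weak_deriv S z x) =
        (LINT x|lebesgue_on S. (u x + f x) * z x)) \<and>
      (AE x in lebesgue_on S. weak_deriv S y x \<le> \<psi> x)}"

definition cost ::
    "real set \<Rightarrow> real \<Rightarrow> (real \<Rightarrow> real) \<Rightarrow> (real \<Rightarrow> real) \<times> (real \<Rightarrow> real) \<Rightarrow> real"
  where "cost S \<beta> y_d = (\<lambda>(y, u).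
    1 / 2 * ((L2_norm S (\<lambda>x. y x - y_d x))\<^sup>2 + \<beta> * (L2_norm S u)\<^sup>2))"

end

theory Submission
  imports Defs
begin

text \<open>
  Write \<open>I = {-1<..<1}\<close> and let \<open>p = y'\<close>.  The state equation says \<open>u = - (p' + f)\<close>, and since \<open>y\<close>
  vanishes at both end points, \<open>p\<close> has integral zero.  So the problem is an obstacle problem for \<open>p \<in> H\<^sup>1\<close> with the constraint
  \<open>p \<le> \<psi>\<close> and one linear side condition.  Weakly differentiable functions of one variable are primitives
  (\<open>weak_deriv_primitive_rep\<close>), so the gap \<open>s = \<psi> - p\<close> has a continuous nonnegative
  representative, whose integral is positive because \<open>\<psi>\<close> has positive integral.  Hence \<open>s\<close> is bounded away
  from zero on some interval (\<open>gap_of_minimizer\<close>).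

  Perturbing \<open>y\<close> by test functions \<open>\<Phi>\<close> such that \<open>y'\<close> stays below \<open>\<psi>\<close> gives a variational inequality for
  \<open>W\<^sub>0 = H\<^sub>0 - \<beta> u\<close>, where \<open>H\<^sub>0'' = y - y\<^sub>d\<close> (\<open>variational_inequality\<close>).  The admissible directions
  \<open>\<Phi>'\<close> have mean zero.  A bump sitting where \<open>s\<close> is bounded away from zero can absorb any mean, and this
  produces a Lagrange multiplier \<open>l\<close> explicitly (\<open>multiplier\<close>): the function \<open>W = W\<^sub>0 - l x\<close>
  is nondecreasing in the sense of distributions, and constant on the intervals where \<open>s > 0\<close>.

  It remains to see that \<open>W\<close> is weakly differentiable.  By construction \<open>\<beta> s' = M - W\<close> with
  \<open>M = \<beta> (\<psi>' + f) + H\<^sub>0 - l x\<close>, a function in \<open>H\<^sup>1\<close>.  At a contact point \<open>s\<close> has a minimum, so the one-sided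
  limits of \<open>M - W\<close> there cannot decrease across the point, whereas \<open>- W\<close> cannot jump upwards; hence \<open>W\<close> is continuous at
  contact points and equals \<open>M\<close> there.  So \<open>W\<close> coincides with \<open>M\<close> on the contact set and is constant on
  each gap of it; over a gap between two contact points the increment of \<open>M\<close> therefore vanishes.  Summing over the gaps,
  \<open>W\<close> is a primitive of the function that equals \<open>M'\<close> on the contact set and \<open>0\<close> elsewhere, which is in \<open>L\<^sub>2\<close>
  (locale \<open>obstacle_contact\<close>, \<open>obstacle_multiplier_regularity\<close>).  Solving for \<open>u\<close> gives \<open>u \<in> H\<^sup>1\<close>, and
  \<open>y'' = - (u + f)\<close> gives \<open>y \<in> H\<^sup>3\<close>.
\<close>

section \<open>Smooth functions and bumps\<close>

definition smooth :: "(real \<Rightarrow> real) \<Rightarrow> bool"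
  where "smooth g \<longleftrightarrow> (\<forall>n. (deriv ^^ n) g differentiable_on UNIV)"

text \<open>
    Finite linear combinations of functions in \<open>B\<close>, used to prove smoothness by coinduction: if every
    function in \<open>B\<close> has a derivative in the linear span of \<open>B\<close>, then the whole span is closed under
    differentiation and so consists of smooth functions.
\<close>

inductive_set lincomb :: "(real \<Rightarrow> real) set \<Rightarrow> (real \<Rightarrow> real) set" for B
  where base: "g \<in> B \<Longrightarrow> g \<in> lincomb B"
  | comb: "g \<in> lincomb B \<Longrightarrow> h \<in> lincomb B \<Longrightarrow> (\<lambda>x. c * g x + d * h x) \<in> lincomb B"

lemma smooth_if_derivs_lincomb:
  assumes "\<And>g. g \<in> B \<Longrightarrow> \<exists>g'\<in>lincomb B. \<forall>x. (g has_real_derivative g' x) (at x)"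
    and "g \<in> lincomb B"
  shows "smooth g"
proof -
  have *: "\<exists>g'\<in>lincomb B. \<forall>x. (g has_real_derivative g' x) (at x)" if "g \<in> lincomb B" for g
    using that
  proof induction
    case (comb g h c d)
    then obtain g' h' where d: "\<And>x. (g has_real_derivative g' x) (at x)"
        "\<And>x. (h has_real_derivative h' x) (at x)" and m: "g' \<in> lincomb B" "h' \<in> lincomb B"
      by blast
    have "((\<lambda>x. c * g x + d * h x) has_real_derivative c * g' x + d * h' x) (at x)" for x
      by (auto intro!: derivative_eq_intros d)
    with lincomb.comb[OF m] show ?case by (intro bexI[rotated] allI)
  qed (fact assms(1))
  have "(deriv ^^ n) g \<in> lincomb B" for n
  proof (induction n)
    case (Suc n)
    then obtain g' where "g' \<in> lincomb B" "\<forall>x. ((deriv ^^ n) g has_real_derivative g' x) (at x)"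
      using * by blast
    moreover from this have "deriv ((deriv ^^ n) g) = g'" by (auto intro!: DERIV_imp_deriv)
    ultimately show ?case by simp
  qed (use assms in simp)
  then show ?thesis
    unfolding smooth_def differentiable_on_def using * real_differentiable_def by fastforce
qed

lemma smooth_deriv: assumes "smooth g" shows "smooth (deriv g)"
  unfolding smooth_def
proof
  fix n show "(deriv ^^ n) (deriv g) differentiable_on UNIV"
    using assms[unfolded smooth_def, rule_format, of "Suc n"] by (simp add: funpow_swap1)
qed

lemma smooth_has_deriv: assumes "smooth g" shows "(g has_real_derivative deriv g x) (at x)"
  using assms[unfolded smooth_def, rule_format, of 0]
  by (simp add: differentiable_on_def DERIV_deriv_iff_real_differentiable)

lemma smooth_if_deriv_smooth:
  assumes "\<And>x. (g has_real_derivative g' x) (at x)" "smooth g'"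
  shows "smooth g"
proof -
  have "deriv g = g'" using assms(1) by (auto intro!: DERIV_imp_deriv)
  moreover have "g differentiable_on UNIV"
    using assms(1) by (auto simp: differentiable_on_def real_differentiable_def)
  ultimately have "(deriv ^^ n) g differentiable_on UNIV" for n
    using assms(2) by (cases n) (simp_all add: smooth_def funpow_swap1)
  then show ?thesis by (simp add: smooth_def)
qed

lemma smooth_continuous_on: "smooth g \<Longrightarrow> continuous_on A g"
  by (meson DERIV_isCont continuous_at_imp_continuous_on smooth_has_deriv)

lemma smooth_const: "smooth (\<lambda>x. c)"
proof (rule smooth_if_derivs_lincomb[of "range (\<lambda>c x. c)"])
  show "\<exists>g'\<in>lincomb (range (\<lambda>c x. c)). \<forall>x. (g has_real_derivative g' x) (at x)"
    if "g \<in> range (\<lambda>c x. c)" for g :: "real \<Rightarrow> real"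
    using that by (intro bexI[of _ "\<lambda>x. 0"]) (auto intro: lincomb.base)
qed (auto intro: lincomb.base)

lemma smooth_comb:
  assumes "smooth g" "smooth h" shows "smooth (\<lambda>x. c * g x + d * h x)"
proof (rule smooth_if_derivs_lincomb[of "Collect smooth"])
  show "\<exists>g'\<in>lincomb (Collect smooth). \<forall>x. (g has_real_derivative g' x) (at x)"
    if "g \<in> Collect smooth" for g
    using that smooth_deriv smooth_has_deriv by (auto intro: lincomb.base)
qed (use assms in \<open>auto intro: lincomb.intros\<close>)

text \<open>
    The products of two smooth functions are closed under differentiation up to sums, by the Leibniz rule.
\<close>

lemma smooth_mult:
  assumes "smooth g" "smooth h" shows "smooth (\<lambda>x. g x * h x)"
proof -
  let ?B = "{\<lambda>x. a x * b x |a b. smooth a \<and> smooth b}"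
  have "\<exists>g'\<in>lincomb ?B. \<forall>x. (g has_real_derivative g' x) (at x)" if "g \<in> ?B" for g
  proof -
    from that obtain a b where g: "g = (\<lambda>x. a x * b x)" and ab: "smooth a" "smooth b" by blast
    have "(\<lambda>x. deriv a x * b x) \<in> lincomb ?B" "(\<lambda>x. a x * deriv b x) \<in> lincomb ?B"
      using ab smooth_deriv by (blast intro: lincomb.base)+
    from lincomb.comb[OF this, of 1 1]
    have "(\<lambda>x. deriv a x * b x + a x * deriv b x) \<in> lincomb ?B" by simp
    moreover have "(g has_real_derivative deriv a x * b x + a x * deriv b x) (at x)" for x
      unfolding g by (auto intro!: derivative_eq_intros smooth_has_deriv ab)
    ultimately show ?thesis by (intro bexI[rotated] allI)
  qed
  moreover have "(\<lambda>x. g x * h x) \<in> ?B" using assms by blast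
  ultimately show ?thesis by (rule smooth_if_derivs_lincomb[OF _ lincomb.base])
qed

lemma smooth_power: "smooth g \<Longrightarrow> smooth (\<lambda>x. g x ^ n)"
  by (induction n) (auto intro: smooth_const smooth_mult)

lemma smooth_affine:
  assumes "smooth g" shows "smooth (\<lambda>x. g (c * x + d))"
proof -
  let ?B = "{\<lambda>x. a (c * x + d) |a. smooth a}"
  have "\<exists>g'\<in>lincomb ?B. \<forall>x. (g has_real_derivative g' x) (at x)" if "g \<in> ?B" for g
  proof -
    from that obtain a where g: "g = (\<lambda>x. a (c * x + d))" and a: "smooth a" by blast
    have "(\<lambda>x. deriv a (c * x + d)) \<in> lincomb ?B"
      using a smooth_deriv by (blast intro: lincomb.base)
    from lincomb.comb[OF this this, of c 0]
    have "(\<lambda>x. c * deriv a (c * x + d)) \<in> lincomb ?B" by simp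
    moreover have "(g has_real_derivative c * deriv a (c * x + d)) (at x)" for x
      unfolding g
      by (rule DERIV_chain2[OF smooth_has_deriv[OF a], THEN DERIV_cong])
        (auto intro!: derivative_eq_intros)
    ultimately show ?thesis by (intro bexI[rotated] allI)
  qed
  moreover have "(\<lambda>x. g (c * x + d)) \<in> ?B" using assms by blast
  ultimately show ?thesis by (rule smooth_if_derivs_lincomb[OF _ lincomb.base])
qed

text \<open>
    Powers of \<open>1/x\<close> times the function \<open>exp (-1/x)\<close> that is flat at \<open>0\<close>.  Including the powers makes the
    family closed under differentiation up to linear combinations.
\<close>

definition flat_pow :: "nat \<Rightarrow> real \<Rightarrow> real"
  where "flat_pow k x = (if x > 0 then exp (- 1 / x) / x ^ k else 0)"

lemma flat_pow_has_deriv: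
  "(flat_pow k has_real_derivative flat_pow (k + 2) x - k * flat_pow (k + 1) x) (at x)"
proof -
  consider "x > 0" | "x < 0" | "x = 0" by linarith
  then show ?thesis
  proof cases
    case 1
    have "((\<lambda>x. exp (- inverse x) * inverse x ^ k) has_real_derivative
        exp (- inverse x) * inverse x ^ (k + 2) - k * (exp (- inverse x) * inverse x ^ (k + 1))) (at x)"
    proof -
      have i: "(inverse has_real_derivative - (inverse x ^ Suc (Suc 0))) (at x)"
        using 1 by (intro DERIV_inverse) auto
      have "((\<lambda>x. exp (- inverse x)) has_real_derivative exp (- inverse x) * inverse x ^ 2) (at x)"
        using DERIV_chain2[OF DERIV_exp DERIV_minus[OF i]] by (simp add: power2_eq_square)
      from DERIV_mult[OF this DERIV_power[OF i, of k]] show ?thesis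
        by (rule DERIV_cong) (cases k; simp add: power2_eq_square algebra_simps)
    qed
    then have "((\<lambda>x. exp (- 1 / x) / x ^ k) has_real_derivative
        exp (- 1 / x) / x ^ (k + 2) - k * (exp (- 1 / x) / x ^ (k + 1))) (at x)"
      by (simp add: divide_inverse power_inverse)
    then have "(flat_pow k has_real_derivative
        exp (- 1 / x) / x ^ (k + 2) - k * (exp (- 1 / x) / x ^ (k + 1))) (at x)"
      by (rule has_field_derivative_transform_within_open[of _ _ _ "{0<..}"])
        (use 1 in \<open>auto simp: flat_pow_def\<close>)
    then show ?thesis using 1 by (simp add: flat_pow_def)
  next
    case 2
    have "(flat_pow k has_real_derivative 0) (at x)"
      by (rule has_field_derivative_transform_within_open[of "\<lambda>x. 0" _ _ "{..<0}"])
        (use 2 in \<open>auto simp: flat_pow_def\<close>)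
    then show ?thesis using 2 by (simp add: flat_pow_def)
  next
    case 3
    have "((\<lambda>h::real. exp (- 1 / h) / h ^ Suc k) \<longlongrightarrow> 0) (at_right 0)"
    proof -
      have "((\<lambda>t::real. t ^ Suc k / exp t) \<longlongrightarrow> 0) at_top"
        by (rule tendsto_power_div_exp_0)
      then have "((\<lambda>h::real. inverse h ^ Suc k / exp (inverse h)) \<longlongrightarrow> 0) (at_right 0)"
        by (rule filterlim_compose[OF _ filterlim_inverse_at_top_right])
      then show ?thesis
        by (simp add: exp_minus field_simps)
    qed
    then have "((\<lambda>h. flat_pow k h / h) \<longlongrightarrow> 0) (at_right 0)"
      by (rule Lim_transform_eventually)
        (auto simp: eventually_at_filter flat_pow_def field_simps)
    moreover have "((\<lambda>h. flat_pow k h / h) \<longlongrightarrow> 0) (at_left 0)"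
      by (rule Lim_transform_eventually[of "\<lambda>h. 0"])
        (auto simp: eventually_at_filter flat_pow_def)
    ultimately have "((\<lambda>h. flat_pow k h / h) \<longlongrightarrow> 0) (at 0)"
      by (simp add: filterlim_at_split)
    then show ?thesis using 3 by (simp add: DERIV_def flat_pow_def)
  qed
qed

lemma smooth_flat_pow: "smooth (flat_pow k)"
proof (rule smooth_if_derivs_lincomb[of "range flat_pow"])
  show "\<exists>g'\<in>lincomb (range flat_pow). \<forall>x. (g has_real_derivative g' x) (at x)"
    if gr: "g \<in> range flat_pow" for g
  proof -
    from gr obtain k where g: "g = flat_pow k" by blast
    have "(\<lambda>x. 1 * flat_pow (k + 2) x + (- real k) * flat_pow (k + 1) x) \<in> lincomb (range flat_pow)"
      by (intro lincomb.comb lincomb.base) auto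
    then show ?thesis unfolding g
      by (intro bexI[of _ "\<lambda>x. flat_pow (k + 2) x - k * flat_pow (k + 1) x"])
        (use flat_pow_has_deriv in auto)
  qed
qed (auto intro: lincomb.base)

text \<open>
    The product \<open>b\<close> of two flat functions is smooth, has values strictly between \<open>0\<close> and \<open>1\<close> on \<open>{0<..<1}\<close>, and
    vanishes outside.  Hence \<open>1 - (1 - b) ^ n\<close> increases pointwise to the indicator of \<open>{0<..<1}\<close>: a smooth
    approximation of an indicator from inside, obtained without convolution.
\<close>

definition bump :: "nat \<Rightarrow> real \<Rightarrow> real"
  where "bump n x = 1 - (1 - flat_pow 0 x * flat_pow 0 (1 - x)) ^ n"

lemma smooth_bump: "smooth (bump n)"
proof -
  have "smooth (\<lambda>x. flat_pow 0 x * flat_pow 0 (1 - x))"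
    using smooth_mult[OF smooth_flat_pow smooth_affine[OF smooth_flat_pow, of 0 "-1" 1]] by simp
  from smooth_comb[OF smooth_const this, of 1 1 "-1"]
  have "smooth (\<lambda>x. (1 - flat_pow 0 x * flat_pow 0 (1 - x)) ^ n)"
    by (intro smooth_power) simp
  from smooth_comb[OF smooth_const this, of 1 1 "-1"] show ?thesis
    unfolding bump_def by simp
qed

lemma flat_factor:
  "x \<in> {0<..<1} \<Longrightarrow> flat_pow 0 x * flat_pow 0 (1 - x) \<in> {0<..<1}"
  "x \<notin> {0<..<1} \<Longrightarrow> flat_pow 0 x * flat_pow 0 (1 - x) = 0"
proof -
  assume "x \<in> {0<..<1}"
  then have "exp (- 1 / x) < 1" "exp (- 1 / (1 - x)) < 1" by auto
  then have "exp (- 1 / x) * exp (- 1 / (1 - x)) < 1 * 1" by (intro mult_strict_mono) auto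
  with \<open>x \<in> {0<..<1}\<close> show "flat_pow 0 x * flat_pow 0 (1 - x) \<in> {0<..<1}"
    by (simp add: flat_pow_def)
qed (auto simp: flat_pow_def)

lemma bump_range: "bump n x \<in> {0..1}"
proof -
  have "1 - flat_pow 0 x * flat_pow 0 (1 - x) \<in> {0..1}"
    using flat_factor[of x] by (cases "x \<in> {0<..<1}") auto
  then show ?thesis by (auto simp: bump_def power_le_one)
qed

lemma bump_outside: "x \<notin> {0<..<1} \<Longrightarrow> bump n x = 0"
  by (simp add: bump_def flat_factor(2))

lemma bump_tendsto: "(\<lambda>n. bump n x) \<longlonglongrightarrow> indicator {0<..<1} x"
proof (cases "x \<in> {0<..<1}")
  case True
  have "(\<lambda>n. 1 - (1 - flat_pow 0 x * flat_pow 0 (1 - x)) ^ n) \<longlonglongrightarrow> 1 - 0"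
    using flat_factor(1)[OF True] by (intro tendsto_intros LIMSEQ_realpow_zero) auto
  with True show ?thesis by (simp add: bump_def)
qed (simp add: bump_outside)

section \<open>Integration over the interval\<close>

abbreviation (input) ivl :: "real set" where "ivl \<equiv> {-1<..<1}"
abbreviation (input) leb :: "real measure" where "leb \<equiv> lebesgue_on ivl"

lemma finite_measure_leb: "finite_measure leb"
  by (rule finite_measure_lebesgue_on) (metis box_real(1) lmeasurable_box)

lemma sets_ivl: "ivl \<inter> space lebesgue \<in> sets lebesgue"
  using fmeasurableD[OF lmeasurable_box[of "-1 :: real" 1]] by simp

lemma measurable_leb [measurable (raw)]: "f \<in> borel_measurable borel \<Longrightarrow> f \<in> borel_measurable leb"
  by (simp add: measurable_completion measurable_restrict_space1)

lemma continuous_on_measurable_leb: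
  "continuous_on {-1..1} f \<Longrightarrow> (f :: real \<Rightarrow> real) \<in> borel_measurable leb"
  by (rule continuous_imp_measurable_on_sets_lebesgue) (auto intro: continuous_on_subset)

lemma continuous_on_bounded_ivl:
  assumes "continuous_on {-1..1} (f :: real \<Rightarrow> real)"
  obtains B where "B \<ge> 0" "\<And>x. x \<in> {-1..1} \<Longrightarrow> \<bar>f x\<bar> \<le> B"
proof -
  have "bounded (f ` {-1..1})"
    by (intro compact_imp_bounded compact_continuous_image assms compact_Icc)
  then obtain B where "\<forall>x\<in>{-1..1}. \<bar>f x\<bar> \<le> B" by (auto simp: bounded_iff)
  with that[of "\<bar>B\<bar>"] show ?thesis by (meson abs_ge_self abs_ge_zero order_trans)
qed

lemma L2_measurable: "u \<in> L2_space ivl \<Longrightarrow> u \<in> borel_measurable leb"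
  by (simp add: L2_space_def)

lemma L2_integrable: "u \<in> L2_space ivl \<Longrightarrow> integrable leb u"
  by (simp add: L2_space_def finite_measure.square_integrable_imp_integrable[OF finite_measure_leb])

lemma L2_mult_integrable:
  assumes "u \<in> L2_space ivl" "v \<in> L2_space ivl" shows "integrable leb (\<lambda>x. u x * v x)"
proof (rule Bochner_Integration.integrable_bound)
  show "integrable leb (\<lambda>x. (u x)\<^sup>2 + (v x)\<^sup>2)"
    using assms by (auto simp: L2_space_def)
  show "(\<lambda>x. u x * v x) \<in> borel_measurable leb"
    using assms by (auto simp: L2_space_def)
  have "\<bar>u x * v x\<bar> \<le> (u x)\<^sup>2 + (v x)\<^sup>2" for x
  proof -
    have "0 \<le> \<bar>u x * v x\<bar>" "2 * \<bar>u x * v x\<bar> \<le> (u x)\<^sup>2 + (v x)\<^sup>2"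
      using sum_squares_bound[of "\<bar>u x\<bar>" "\<bar>v x\<bar>"] by (auto simp: abs_mult mult.assoc)
    then show ?thesis by linarith
  qed
  then show "AE x in leb. norm (u x * v x) \<le> norm ((u x)\<^sup>2 + (v x)\<^sup>2)" by simp
qed

lemma L2_comb:
  assumes "u \<in> L2_space ivl" "v \<in> L2_space ivl"
  shows "(\<lambda>x. c * u x + d * v x) \<in> L2_space ivl"
proof -
  have [measurable]: "u \<in> borel_measurable leb" "v \<in> borel_measurable leb"
    using assms by (auto simp: L2_measurable)
  have "integrable leb (\<lambda>x. c\<^sup>2 * (u x)\<^sup>2 + 2 * c * d * (u x * v x) + d\<^sup>2 * (v x)\<^sup>2)"
    using assms L2_mult_integrable[OF assms]
    by (intro Bochner_Integration.integrable_add integrable_mult_right) (auto simp: L2_space_def)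
  then have "integrable leb (\<lambda>x. (c * u x + d * v x)\<^sup>2)"
    by (rule Bochner_Integration.integrable_cong[THEN iffD1, rotated 2]) (auto simp: power2_eq_square algebra_simps)
  then show ?thesis by (simp add: L2_space_def)
qed

lemma L2_diff:
  "u \<in> L2_space ivl \<Longrightarrow> v \<in> L2_space ivl \<Longrightarrow> (\<lambda>x. u x - v x) \<in> L2_space ivl"
  using L2_comb[of u v 1 "-1"] by simp

lemma L2_bounded_mult:
  assumes u: "u \<in> L2_space ivl" and b: "b \<in> borel_measurable leb" "\<And>x. x \<in> ivl \<Longrightarrow> \<bar>b x\<bar> \<le> B"
  shows "(\<lambda>x. u x * b x) \<in> L2_space ivl"
proof -
  have [measurable]: "u \<in> borel_measurable leb" "b \<in> borel_measurable leb"
    using u b by (auto simp: L2_measurable)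
  have "integrable leb (\<lambda>x. (u x * b x)\<^sup>2)"
  proof (rule Bochner_Integration.integrable_bound)
    show "integrable leb (\<lambda>x. (u x)\<^sup>2 * B\<^sup>2)" using u by (auto simp: L2_space_def)
    have "(u x * b x)\<^sup>2 \<le> (u x)\<^sup>2 * B\<^sup>2" if "x \<in> ivl" for x
    proof -
      have "\<bar>b x\<bar>\<^sup>2 \<le> B\<^sup>2" using b(2)[OF that] by (rule power_mono) simp
      then show ?thesis by (simp add: power_mult_distrib mult_left_mono)
    qed
    then show "AE x in leb. norm ((u x * b x)\<^sup>2) \<le> norm ((u x)\<^sup>2 * B\<^sup>2)"
      by (intro AE_I2) auto
  qed simp
  then show ?thesis by (simp add: L2_space_def)
qed

lemma L2_one: "(\<lambda>x. 1) \<in> L2_space ivl"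
  by (simp add: L2_space_def finite_measure.integrable_const[OF finite_measure_leb])

lemma continuous_L2:
  assumes "continuous_on {-1..1} f" shows "f \<in> L2_space ivl"
proof -
  obtain B where B: "\<And>x. x \<in> {-1..1} \<Longrightarrow> \<bar>f x\<bar> \<le> B"
    using continuous_on_bounded_ivl[OF assms] by blast
  show ?thesis
    using L2_bounded_mult[OF L2_one continuous_on_measurable_leb[OF assms], of B] B by simp
qed

text \<open>
    The bridge between Lebesgue integrals over \<^term>\<open>ivl\<close> and gauge integrals over subintervals.  Primitives are
    written with the latter, since those come with the fundamental theorem of calculus.
\<close>

lemma integrable_on_subinterval:
  fixes w :: "real \<Rightarrow> real"
  assumes "integrable leb w" "-1 \<le> a" "b \<le> 1"
  shows "w integrable_on {a..b}"
    and "(LINT x|leb. indicator {a<..<b} x * w x) = integral {a..b} w"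
proof -
  have "set_integrable lebesgue ivl w"
    using assms(1) integrable_restrict_space[OF sets_ivl, of w] by (simp add: set_integrable_def)
  then have *: "set_integrable lebesgue {a<..<b} w"
    by (rule set_integrable_subset) (use assms in auto)
  then show "w integrable_on {a..b}"
    using set_lebesgue_integral_eq_integral(1) integrable_on_Icc_iff_Ioo by blast
  have "(LINT x|leb. indicator {a<..<b} x * w x) = (LINT x:{a<..<b}|lebesgue. w x)"
    unfolding set_lebesgue_integral_def
    by (subst integral_restrict_space[OF sets_ivl]) (use assms in \<open>auto intro!: Bochner_Integration.integral_cong simp: indicator_def\<close>)
  then show "(LINT x|leb. indicator {a<..<b} x * w x) = integral {a..b} w"
    using set_lebesgue_integral_eq_integral(2)[OF *] by (simp add: integral_open_interval_real)
qed

lemma integrable_mult_bounded: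
  assumes w: "integrable leb w" and b: "b \<in> borel_measurable leb" "\<And>x. x \<in> ivl \<Longrightarrow> \<bar>b x\<bar> \<le> B"
  shows "integrable leb (\<lambda>x. w x * b x :: real)"
proof (rule Bochner_Integration.integrable_bound)
  show "integrable leb (\<lambda>x. w x * B)" using w by simp
  show "(\<lambda>x. w x * b x) \<in> borel_measurable leb" using w b(1) by measurable
  have "\<bar>w x * b x\<bar> \<le> \<bar>w x * B\<bar>" if "x \<in> ivl" for x
    using b(2)[OF that] by (auto simp: abs_mult intro!: mult_left_mono)
  then show "AE x in leb. norm (w x * b x) \<le> norm (w x * B)" by (intro AE_I2) auto
qed

lemma integrable_mult_continuous:
  assumes w: "integrable leb w" and b: "continuous_on {-1..1} b"
  shows "integrable leb (\<lambda>x. w x * b x :: real)"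
proof -
  obtain B where B: "\<And>x. x \<in> {-1..1} \<Longrightarrow> \<bar>b x\<bar> \<le> B"
    using continuous_on_bounded_ivl[OF b] by blast
  show ?thesis
    by (rule integrable_mult_bounded[OF w continuous_on_measurable_leb[OF b], of B]) (use B in auto)
qed

lemma subset_Pow_UNIV: "A \<subseteq> Pow UNIV"
  by simp

text \<open>
    The sets over which the integral vanishes form a Dynkin system containing the open intervals, hence
    contain all Borel sets, and an integrable function with vanishing integrals over Borel sets is zero.
\<close>

lemma AE_zero_if_interval_integrals_zero:
  assumes w: "integrable leb w"
    and zero: "\<And>a b. -1 < a \<Longrightarrow> a < b \<Longrightarrow> b < 1 \<Longrightarrow> integral {a..b} w = (0::real)"
  shows "AE x in leb. w x = 0"
proof -
  have full: "integral {a..b} w = 0" if "-1 \<le> a" "b \<le> 1" for a b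
  proof (cases "a < b")
    case True
    define F where "F x = integral {-1..x} w" for x
    have w': "w integrable_on {-1..1}" by (rule integrable_on_subinterval[OF w]) auto
    then have cont: "continuous_on {-1..1} F"
      unfolding F_def by (rule indefinite_integral_continuous_1)
    have diff: "integral {x..y} w = F y - F x" if "-1 \<le> x" "x \<le> y" "y \<le> 1" for x y
    proof -
      have "w integrable_on {-1..y}" using integrable_on_subinterval[OF w] that by auto
      from Henstock_Kurzweil_Integration.integral_combine[OF that(1,2) this] show ?thesis by (simp add: F_def)
    qed
    have const: "F x = F 0" if "x \<in> {-1<..<1}" for x
      using zero[of 0 x] zero[of x 0] diff[of 0 x] diff[of x 0] that
      by (cases x "0::real" rule: linorder_cases) auto
    have const': "F x = F 0" if "x \<in> {-1..1}" for x
    proof (rule continuous_constant_on_closure[of "{-1<..<1}" F])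
      show "continuous_on (closure {-1<..<1}) F" "x \<in> closure {-1<..<1}" using cont that by auto
    qed (rule const)
    show ?thesis using diff[of a b] const'[of a] const'[of b] that True by auto
  qed (cases "a = b"; simp)
  \<comment> \<open>Extend by zero and pass to a Borel measurable version, so that Borel sets suffice.\<close>
  define f where "f x = indicator ivl x * w x" for x
  have f: "integrable lebesgue f" using w integrable_restrict_space[OF sets_ivl, of w] by (simp add: f_def[abs_def])
  then obtain g where g: "g \<in> borel_measurable lborel" and "AE x in lborel. f x = g x"
    using completion_ex_borel_measurable_real[of f lborel] by auto
  then have fg: "AE x in lebesgue. f x = g x" by (intro AE_completion)
  have g': "g \<in> borel_measurable lebesgue" using g by (simp add: measurable_completion)
  have "integrable lebesgue g"
    using f fg g' by (subst integrable_cong_AE[of _ _ f]) auto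
  then have gi: "integrable lborel g" using g by (simp add: integrable_completion)
  have gset: "set_integrable lborel A g" if "A \<in> sets borel" for A
    using gi that unfolding set_integrable_def by (intro integrable_mult_indicator) auto
  have box0: "(LINT x:{a<..<b}|lborel. g x) = 0" for a b
  proof -
    have ind: "indicat_real {a<..<b} \<in> borel_measurable lebesgue"
      by (intro measurable_completion borel_measurable_indicator) simp
    have "(LINT x:{a<..<b}|lborel. g x) = (LINT x|lebesgue. indicator {a<..<b} x * g x)"
      unfolding set_lebesgue_integral_def real_scaleR_def
      by (rule integral_completion[symmetric]) (use g in measurable)
    also have "\<dots> = (LINT x|lebesgue. indicator {a<..<b} x * f x)"
      by (rule integral_cong_AE) (use fg f g' ind in \<open>auto intro!: borel_measurable_times\<close>)
    also have "\<dots> = (LINT x|leb. indicator {max a (-1)<..<min b 1} x * w x)"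
      by (subst integral_restrict_space[OF sets_ivl])
        (auto simp: f_def indicator_def intro!: Bochner_Integration.integral_cong)
    also have "\<dots> = 0"
      by (subst integrable_on_subinterval(2)[OF w]) (auto intro!: full)
    finally show ?thesis .
  qed
  have "(LINT x:A|lborel. g x) = 0" if "A \<in> sets borel" for A
  proof -
    have gen: "sets borel = sigma_sets UNIV (range (\<lambda>(a, b). {a<..<b :: real}))"
      by (subst borel_eq_box) (simp add: case_prod_beta)
    have "Int_stable (range (\<lambda>(a, b). {a<..<b :: real}))"
      by (auto simp: Int_stable_def)
    moreover have "A \<in> sigma_sets UNIV (range (\<lambda>(a, b). {a<..<b :: real}))"
      using that gen by simp
    ultimately show ?thesis
    proof (induction rule: sigma_sets_induct_disjoint[OF _ subset_Pow_UNIV, consumes 2, case_names basic empty compl union])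
      case (basic A)
      then show ?case using box0 by auto
    next
      case (compl A)
      have A: "A \<in> sets borel" using compl(1) gen by simp
      have "(LINT x:UNIV|lborel. g x) = (LINT x|leb. indicator {-1<..<1} x * w x)"
      proof -
        have "(LINT x:UNIV|lborel. g x) = (LINT x|lebesgue. g x)"
          unfolding set_lebesgue_integral_def using integral_completion[OF g] by simp
        also have "\<dots> = (LINT x|lebesgue. f x)"
          by (rule integral_cong_AE) (use fg f g' in auto)
        also have "\<dots> = (LINT x|leb. indicator {-1<..<1} x * w x)"
          by (subst integral_restrict_space[OF sets_ivl])
            (auto simp: f_def indicator_def intro!: Bochner_Integration.integral_cong)
        finally show ?thesis .
      qed
      also have "\<dots> = 0"
        by (subst integrable_on_subinterval(2)[OF w]) (auto intro!: full)
      finally have "(LINT x:(UNIV - A) \<union> A|lborel. g x) = 0" by simp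
      then show ?case
        using set_integral_Un[of "UNIV - A" A lborel g] gset[OF A] gset[of "UNIV - A"] A compl(2)
        by auto
    next
      case (union A)
      have A: "A i \<in> sets borel" for i using union(2) gen by auto
      have "(LINT x:(\<Union>i. A i)|lborel. g x) = (\<Sum>i. (LINT x:(A i)|lborel. g x))"
        by (rule lebesgue_integral_countable_add)
          (use A union(1) gset in \<open>auto simp: disjoint_family_on_def\<close>)
      then show ?case using union(3) by simp
    qed (simp add: set_lebesgue_integral_def)
  qed
  then have "AE x in lborel. g x = 0"
    by (intro sigma_finite_measure.density_zero[OF sigma_finite_lborel] gi) auto
  then have "AE x in lebesgue. g x = 0" by (rule AE_completion)
  with fg have "AE x in lebesgue. f x = 0" by eventually_elim auto
  then show ?thesis
    by (subst AE_restrict_space_iff[OF sets_ivl]) (auto simp: f_def elim!: eventually_mono)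
qed

section \<open>Test functions and the fundamental lemma of the calculus of variations\<close>

lemma test_functionI:
  assumes "smooth \<phi>" "-1 < a" "b < 1" "\<And>x. x \<notin> {a..b} \<Longrightarrow> \<phi> x = 0"
  shows "\<phi> \<in> test_functions ivl"
proof -
  have "closure {x. \<phi> x \<noteq> 0} \<subseteq> {a..b}"
    by (rule closure_minimal) (use assms(4) in blast, simp)
  moreover from this have "compact (closure {x. \<phi> x \<noteq> 0})"
    by (metis bounded_closed_interval bounded_subset closed_closure compact_eq_bounded_closed)
  moreover have "{a..b} \<subseteq> ivl" using assms by auto
  ultimately show ?thesis
    using assms(1) unfolding test_functions_def smooth_def mem_Collect_eq by (meson subset_trans)
qed

lemma test_function_smooth: "\<phi> \<in> test_functions ivl \<Longrightarrow> smooth \<phi>"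
  by (simp add: test_functions_def smooth_def)

lemma test_function_support:
  assumes "\<phi> \<in> test_functions ivl"
  obtains r where "0 < r" "r < 1" "\<And>x. x \<notin> {-r..r} \<Longrightarrow> \<phi> x = 0"
proof -
  let ?K = "closure {x. \<phi> x \<noteq> 0}"
  have K: "compact ?K" "?K \<subseteq> ivl" using assms by (auto simp: test_functions_def)
  show ?thesis
  proof (cases "?K = {}")
    case True
    then have "\<phi> x = 0" for x by auto
    then show ?thesis using that[of "1/2"] by simp
  next
    case False
    obtain s where s: "s \<in> ?K" "\<And>t. t \<in> ?K \<Longrightarrow> \<bar>t\<bar> \<le> \<bar>s\<bar>"
      using continuous_attains_sup[OF K(1) False continuous_on_rabs[OF continuous_on_id]] by blast
    have s1: "\<bar>s\<bar> < 1" using subsetD[OF K(2) s(1)] by (simp add: abs_less_iff)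
    have "\<phi> x = 0" if "x \<notin> {- max \<bar>s\<bar> (1/2)..max \<bar>s\<bar> (1/2)}" for x
    proof (rule ccontr)
      assume "\<phi> x \<noteq> 0"
      then have "x \<in> ?K" by (meson closure_subset mem_Collect_eq subset_iff)
      from s(2)[OF this] that show False by (auto simp: abs_le_iff max_def split: if_splits)
    qed
    then show ?thesis by (rule that[of "max \<bar>s\<bar> (1/2)", rotated 2]) (use s1 in auto)
  qed
qed

lemma test_function_comb:
  assumes "\<phi> \<in> test_functions ivl" "\<theta> \<in> test_functions ivl"
  shows "(\<lambda>x. c * \<phi> x + d * \<theta> x) \<in> test_functions ivl"
proof -
  obtain r where r: "0 < r" "r < 1" "\<And>x. x \<notin> {-r..r} \<Longrightarrow> \<phi> x = 0"
    by (rule test_function_support[OF assms(1)]) blast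
  obtain s where s: "0 < s" "s < 1" "\<And>x. x \<notin> {-s..s} \<Longrightarrow> \<theta> x = 0"
    by (rule test_function_support[OF assms(2)]) blast
  show ?thesis
    by (rule test_functionI[of _ "- max r s" "max r s"])
      (use smooth_comb[OF assms[THEN test_function_smooth]] r s in \<open>auto simp: max_def split: if_splits\<close>)
qed

lemma test_function_deriv:
  assumes "\<phi> \<in> test_functions ivl" shows "deriv \<phi> \<in> test_functions ivl"
proof -
  obtain r where r: "0 < r" "r < 1" "\<And>x. x \<notin> {-r..r} \<Longrightarrow> \<phi> x = 0"
    by (rule test_function_support[OF assms(1)]) blast
  show ?thesis
  proof (rule test_functionI)
    show "deriv \<phi> x = 0" if "x \<notin> {-r..r}" for x
    proof (rule DERIV_imp_deriv)
      show "(\<phi> has_real_derivative 0) (at x)"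
        by (rule has_field_derivative_transform_within_open[of "\<lambda>x. 0" _ _ "- {-r..r}"])
          (use r that in \<open>auto simp del: atLeastAtMost_iff\<close>)
    qed
    show "smooth (deriv \<phi>)" by (rule smooth_deriv[OF test_function_smooth[OF assms]])
    show "-1 < -r" using r by simp
  qed (rule r)
qed

lemma test_function_continuous_on: "\<phi> \<in> test_functions ivl \<Longrightarrow> continuous_on A \<phi>"
  using smooth_continuous_on test_function_smooth by blast

lemma test_function_has_deriv:
  "\<phi> \<in> test_functions ivl \<Longrightarrow> (\<phi> has_real_derivative deriv \<phi> x) (at x)"
  using smooth_has_deriv test_function_smooth by blast

lemma test_function_L2: "\<phi> \<in> test_functions ivl \<Longrightarrow> \<phi> \<in> L2_space ivl"
  by (simp add: continuous_L2 test_function_continuous_on)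

lemma deriv_comb_test:
  assumes "\<phi> \<in> test_functions ivl" "\<theta> \<in> test_functions ivl"
  shows "deriv (\<lambda>x. c * \<phi> x + d * \<theta> x) = (\<lambda>x. c * deriv \<phi> x + d * deriv \<theta> x)"
  by (rule ext, rule DERIV_imp_deriv)
    (auto intro!: derivative_eq_intros test_function_has_deriv assms)

lemma integral_leb_eq:
  assumes "integrable leb w" shows "(LINT x|leb. w x) = integral {-1..1} (w :: real \<Rightarrow> real)"
proof -
  have "(LINT x|leb. w x) = (LINT x|leb. indicator {-1<..<1} x * w x)"
    by (intro Bochner_Integration.integral_cong) auto
  then show ?thesis using integrable_on_subinterval(2)[OF assms, of "-1" 1] by simp
qed

lemma integral_test_deriv:
  assumes "\<phi> \<in> test_functions ivl" "t \<le> 1"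
  shows "integral {t..1} (deriv \<phi>) = - \<phi> t"
proof -
  have "((deriv \<phi>) has_integral (\<phi> 1 - \<phi> t)) {t..1}"
    by (rule fundamental_theorem_of_calculus[OF assms(2)])
      (use test_function_has_deriv[OF assms(1)] in
        \<open>auto simp: has_real_derivative_iff_has_vector_derivative[symmetric] intro: has_field_derivative_at_within\<close>)
  moreover have "\<phi> 1 = 0"
    by (rule test_function_support[OF assms(1)]) auto
  ultimately show ?thesis by (simp add: integral_unique)
qed

text \<open>
    The test functions that are derivatives of test functions are exactly those of mean zero; this is the
    direction that needs a construction.
\<close>

lemma test_function_primitive:
  assumes v: "v \<in> test_functions ivl" and "(LINT x|leb. v x) = 0"
  shows "(\<lambda>x. integral {-1..x} v) \<in> test_functions ivl"
    and "((\<lambda>x. integral {-1..x} v) has_real_derivative v x) (at x)"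
proof -
  let ?\<Phi> = "\<lambda>x. integral {-1..x} v"
  obtain r where r: "0 < r" "r < 1" "\<And>x. x \<notin> {-r..r} \<Longrightarrow> v x = 0"
    by (rule test_function_support[OF v]) blast
  have int: "v integrable_on {a..b}" for a b
    by (intro integrable_continuous_real test_function_continuous_on v)
  have zero: "integral {a..b} v = 0" if "b < -r \<or> r < a" for a b
  proof -
    have "integral {a..b} v = integral {a..b} (\<lambda>x. 0)"
      by (intro Henstock_Kurzweil_Integration.integral_cong r(3)) (use that in auto)
    then show ?thesis by simp
  qed
  have left: "?\<Phi> x = 0" if "x < -r" for x
    using zero that by auto
  have tot: "integral {-1..1} v = 0"
    using integral_leb_eq[OF L2_integrable[OF test_function_L2[OF v]]] assms(2) by simp
  have right: "?\<Phi> x = 0" if "r < x" for x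
  proof (cases "x \<le> 1")
    case True
    have "?\<Phi> x + integral {x..1} v = integral {-1..1} v"
      by (rule Henstock_Kurzweil_Integration.integral_combine) (use True that r int in auto)
    then show ?thesis using tot zero that by auto
  next
    case False
    have "integral {-1..1} v + integral {1..x} v = ?\<Phi> x"
      by (rule Henstock_Kurzweil_Integration.integral_combine) (use False that r int in auto)
    then show ?thesis using tot zero[of x 1] r zero[where a=1 and b=x] by auto
  qed
  have deriv: "(?\<Phi> has_real_derivative v x) (at x)" for x
  proof (cases "x < -r")
    case True
    have "(?\<Phi> has_real_derivative 0) (at x)"
      by (rule has_field_derivative_transform_within_open[of "\<lambda>x. 0" _ _ "{..<-r}"])
        (use True left in auto)
    then show ?thesis using r(3)[of x] True by simp
  next
    case False
    have "(?\<Phi> has_real_derivative v x) (at x within {-1..x+1})"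
      by (rule integral_has_real_derivative) (use False r v test_function_continuous_on in auto)
    moreover have "x \<in> interior {-1..x+1}" using False r by auto
    ultimately show ?thesis by (simp only: at_within_interior)
  qed
  then show "(?\<Phi> has_real_derivative v x) (at x)" .
  show "?\<Phi> \<in> test_functions ivl"
  proof (rule test_functionI)
    show "smooth ?\<Phi>" by (rule smooth_if_deriv_smooth[OF deriv test_function_smooth[OF v]])
    show "?\<Phi> x = 0" if "x \<notin> {-r..r}" for x
      using left[of x] right[of x] that by (cases "x < -r") auto
    show "-1 < -r" "r < 1" using r by auto
  qed
qed

text \<open>
    The bumps transported to the interval from \<open>a\<close> to \<open>b\<close>.
\<close>

definition bump_on :: "real \<Rightarrow> real \<Rightarrow> nat \<Rightarrow> real \<Rightarrow> real"
  where "bump_on a b n x = bump n ((x - a) / (b - a))"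

lemma bump_on_range: "bump_on a b n x \<in> {0..1}"
  using bump_range by (simp add: bump_on_def)

lemma affine_in_unit: "a < b \<Longrightarrow> (x - a) / (b - a) \<in> {0<..<1} \<longleftrightarrow> x \<in> {a<..<b :: real}"
  by (auto simp: field_simps)

lemma bump_on_outside: "a < b \<Longrightarrow> x \<notin> {a<..<b} \<Longrightarrow> bump_on a b n x = 0"
  unfolding bump_on_def by (rule bump_outside) (simp only: affine_in_unit not_False_eq_True)

lemma bump_on_test:
  assumes "-1 < a" "a < b" "b < 1" shows "bump_on a b n \<in> test_functions ivl"
proof (rule test_functionI)
  have "smooth (\<lambda>x. bump n (1 / (b - a) * x + (- a / (b - a))))"
    by (intro smooth_affine smooth_bump)
  moreover have "1 / (b - a) * x + (- a / (b - a)) = (x - a) / (b - a)" for x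
    by (simp add: diff_divide_distrib)
  ultimately show "smooth (bump_on a b n)" by (simp add: bump_on_def[abs_def])
  show "bump_on a b n x = 0" if "x \<notin> {a..b}" for x
    by (rule bump_on_outside[OF assms(2)]) (use that in auto)
qed (rule assms)+

text \<open>
    Testing with bumps recovers integrals over intervals, by dominated convergence.
\<close>

lemma bump_on_limit:
  assumes w: "integrable leb w" and ab: "-1 < a" "a < b" "b < 1"
  shows "(\<lambda>n. LINT x|leb. w x * bump_on a b n x) \<longlonglongrightarrow> integral {a..b} w"
proof -
  have "(\<lambda>n. LINT x|leb. w x * bump_on a b n x) \<longlonglongrightarrow> (LINT x|leb. indicator {a<..<b} x * w x)"
  proof (rule integral_dominated_convergence)
    show "integrable leb (\<lambda>x. \<bar>w x\<bar>)" using w by simp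
    show "(\<lambda>x. w x * bump_on a b n x) \<in> borel_measurable leb" for n
      by (intro borel_measurable_times borel_measurable_integrable[OF w]
          L2_measurable[OF test_function_L2[OF bump_on_test[OF ab]]])
    show "(\<lambda>x. indicator {a<..<b} x * w x) \<in> borel_measurable leb"
      by (intro borel_measurable_times borel_measurable_integrable[OF w] measurable_leb) simp
    have "(\<lambda>n. w x * bump_on a b n x) \<longlonglongrightarrow> indicator {a<..<b} x * w x" for x
    proof -
      have "indicator {0<..<1} ((x - a) / (b - a)) = (indicator {a<..<b} x :: real)"
        using affine_in_unit[OF ab(2)] by (auto simp: indicator_def)
      then have "(\<lambda>n. w x * bump_on a b n x) \<longlonglongrightarrow> w x * indicator {a<..<b} x"
        using bump_tendsto[of "(x - a) / (b - a)"] by (intro tendsto_intros) (simp add: bump_on_def)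
      then show ?thesis by (simp add: mult.commute)
    qed
    then show "AE x in leb. (\<lambda>n. w x * bump_on a b n x) \<longlonglongrightarrow> indicator {a<..<b} x * w x" by simp
    have "norm (w x * bump_on a b n x) \<le> \<bar>w x\<bar>" for n x
      using bump_on_range[of a b n x] by (simp add: abs_mult mult_left_le)
    then show "AE x in leb. norm (w x * bump_on a b n x) \<le> \<bar>w x\<bar>" for n by simp
  qed
  then show ?thesis using integrable_on_subinterval(2)[OF w, of a b] ab by simp
qed

lemma bump_on_mass:
  assumes ab: "-1 < a" "a < b" "b < 1"
  shows "(\<lambda>n. LINT x|leb. bump_on a b n x) \<longlonglongrightarrow> b - a"
proof -
  have "(\<lambda>n. LINT x|leb. 1 * bump_on a b n x) \<longlonglongrightarrow> integral {a..b} (\<lambda>x. 1)"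
    by (rule bump_on_limit[OF _ ab]) (rule L2_integrable[OF L2_one])
  then show ?thesis using ab by simp
qed

lemma positive_bump_exists:
  assumes ab: "-1 < a" "a < b" "b < 1"
  obtains \<eta> where "\<eta> \<in> test_functions ivl" "\<And>x. \<eta> x \<ge> 0" "\<And>x. x \<notin> {a<..<b} \<Longrightarrow> \<eta> x = 0"
    "(LINT x|leb. \<eta> x) = 1"
proof -
  from order_tendstoD(1)[OF bump_on_mass[OF ab], of 0] ab
  obtain n where n: "(LINT x|leb. bump_on a b n x) > 0" (is "?m > 0")
    by (auto simp: eventually_sequentially)
  let ?\<eta> = "\<lambda>x. 1 / ?m * bump_on a b n x + 0 * bump_on a b n x"
  show ?thesis
  proof (rule that)
    show "?\<eta> \<in> test_functions ivl" by (intro test_function_comb bump_on_test ab)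
    show "?\<eta> x \<ge> 0" for x using bump_on_range[of a b n x] n by simp
    show "?\<eta> x = 0" if "x \<notin> {a<..<b}" for x using bump_on_outside[OF ab(2) that] by simp
    show "(LINT x|leb. ?\<eta> x) = 1" using n by simp
  qed
qed

lemma AE_zero_if_orthogonal_to_test_functions:
  assumes w: "integrable leb w" and zero: "\<And>\<phi>. \<phi> \<in> test_functions ivl \<Longrightarrow> (LINT x|leb. w x * \<phi> x) = 0"
  shows "AE x in leb. w x = 0"
proof (rule AE_zero_if_interval_integrals_zero[OF w])
  fix a b :: real assume ab: "-1 < a" "a < b" "b < 1"
  show "integral {a..b} w = 0"
    using bump_on_limit[OF w ab] zero[OF bump_on_test[OF ab]] by (simp add: LIMSEQ_const_iff)
qed

text \<open>
    For merely integrable \<open>g\<close>, integration by parts is Fubini's theorem for the function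
    \<open>g t * deriv \<phi> x\<close> on the triangle \<open>t < x\<close>.
\<close>

lemma integration_by_parts_primitive:
  assumes g: "integrable leb g" and \<phi>: "\<phi> \<in> test_functions ivl"
  shows "(LINT x|leb. integral {-1..x} g * deriv \<phi> x) = - (LINT x|leb. g x * \<phi> x)"
proof -
  interpret leb: finite_measure leb by (rule finite_measure_leb)
  interpret P: pair_sigma_finite leb leb ..
  define k where "k x t = deriv \<phi> x * (g t * indicator {..<x} t)" for x t :: real
  have d\<phi>: "deriv \<phi> \<in> L2_space ivl" using \<phi> test_function_deriv test_function_L2 by blast
  have [measurable]: "deriv \<phi> \<in> borel_measurable leb" "g \<in> borel_measurable leb"
    using d\<phi> g L2_measurable by auto
  have id: "(\<lambda>x. x) \<in> borel_measurable leb" by (rule measurable_leb) simp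
  have mind: "(\<lambda>p. indicat_real {..<fst p} (snd p)) \<in> borel_measurable (leb \<Otimes>\<^sub>M leb)"
  proof -
    have "{p \<in> space (leb \<Otimes>\<^sub>M leb). snd p < fst p} \<in> sets (leb \<Otimes>\<^sub>M leb)"
      by (rule borel_measurable_less)
        (auto intro!: measurable_compose[OF measurable_fst id] measurable_compose[OF measurable_snd id])
    then have "indicat_real {p \<in> space (leb \<Otimes>\<^sub>M leb). snd p < fst p} \<in> borel_measurable (leb \<Otimes>\<^sub>M leb)"
      by simp
    then show ?thesis
      by (rule measurable_cong[THEN iffD1, rotated]) (auto simp: indicator_def)
  qed
  have integ: "integrable (leb \<Otimes>\<^sub>M leb) (\<lambda>p. k (fst p) (snd p))"
  proof (rule Bochner_Integration.integrable_bound)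
    show "integrable (leb \<Otimes>\<^sub>M leb) (\<lambda>p. deriv \<phi> (fst p) * g (snd p))"
      by (rule P.Fubini_integrable) (use g L2_integrable[OF d\<phi>] in \<open>auto simp: abs_mult\<close>)
    show "(\<lambda>p. k (fst p) (snd p)) \<in> borel_measurable (leb \<Otimes>\<^sub>M leb)"
      unfolding k_def by (intro borel_measurable_times mind) auto
    show "AE p in leb \<Otimes>\<^sub>M leb. norm (k (fst p) (snd p)) \<le> norm (deriv \<phi> (fst p) * g (snd p))"
      by (rule AE_I2) (auto simp: k_def abs_mult indicator_def)
  qed
  have "(LINT x|leb. integral {-1..x} g * deriv \<phi> x) = (LINT x|leb. LINT t|leb. k x t)"
  proof (rule Bochner_Integration.integral_cong[OF refl])
    fix x assume x: "x \<in> space leb"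
    have "(LINT t|leb. k x t) = (LINT t|leb. deriv \<phi> x * (indicator {-1<..<x} t * g t))"
      unfolding k_def using x
      by (intro Bochner_Integration.integral_cong) (auto simp: indicator_def)
    also have "\<dots> = deriv \<phi> x * (LINT t|leb. indicator {-1<..<x} t * g t)" by simp
    finally have "(LINT t|leb. k x t) = \<dots>" .
    then show "integral {-1..x} g * deriv \<phi> x = (LINT t|leb. k x t)"
      using x by (simp add: integrable_on_subinterval(2)[OF g])
  qed
  also have "\<dots> = (LINT t|leb. LINT x|leb. k x t)"
    using P.Fubini_integral[of k] integ by (simp add: case_prod_beta')
  also have "\<dots> = (LINT t|leb. - (g t * \<phi> t))"
  proof (rule Bochner_Integration.integral_cong[OF refl])
    fix t assume t: "t \<in> space leb"
    have "(LINT x|leb. k x t) = (LINT x|leb. g t * (indicator {t<..<1} x * deriv \<phi> x))"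
      unfolding k_def using t
      by (intro Bochner_Integration.integral_cong) (auto simp: indicator_def)
    also have "\<dots> = g t * (LINT x|leb. indicator {t<..<1} x * deriv \<phi> x)" by simp
    finally have "(LINT x|leb. k x t) = \<dots>" .
    then show "(LINT x|leb. k x t) = - (g t * \<phi> t)"
      using t by (simp add: integrable_on_subinterval(2)[OF L2_integrable[OF d\<phi>]] integral_test_deriv[OF \<phi>])
  qed
  finally show ?thesis by simp
qed

text \<open>
    The lemma of du Bois-Reymond.  Subtracting from a test function \<open>\<theta>\<close> its mean times a fixed bump \<open>\<eta>\<close> of mass one
    gives a derivative of a test function, so \<open>w\<close> acts on \<open>\<theta>\<close> like the constant obtained by testing \<open>w\<close> with \<open>\<eta>\<close>.
\<close>

lemma constant_if_orthogonal_to_test_derivatives: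
  assumes w: "integrable leb w" and zero: "\<And>\<phi>. \<phi> \<in> test_functions ivl \<Longrightarrow> (LINT x|leb. w x * deriv \<phi> x) = 0"
  shows "\<exists>c. AE x in leb. w x = c"
proof -
  obtain \<eta> where \<eta>: "\<eta> \<in> test_functions ivl" and one: "(LINT x|leb. \<eta> x) = 1"
    by (rule positive_bump_exists[of "-1/2" "1/2"]) auto
  define c where "c = (LINT x|leb. w x * \<eta> x)"
  have "(LINT x|leb. (w x - c) * \<theta> x) = 0" if \<theta>: "\<theta> \<in> test_functions ivl" for \<theta>
  proof -
    define d where "d = (LINT x|leb. \<theta> x)"
    define v where "v x = 1 * \<theta> x + (- d) * \<eta> x" for x
    have v: "v \<in> test_functions ivl" unfolding v_def by (intro test_function_comb \<theta> \<eta>)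
    have int: "integrable leb \<theta>" "integrable leb \<eta>"
      using \<theta> \<eta> test_function_L2 L2_integrable by blast+
    have wint: "integrable leb (\<lambda>x. w x * \<theta> x)" "integrable leb (\<lambda>x. w x * \<eta> x)"
      using \<theta> \<eta> w by (auto intro!: integrable_mult_continuous test_function_continuous_on)
    have "(LINT x|leb. v x) = 0"
      unfolding v_def using int one by (simp add: d_def)
    then have "(LINT x|leb. w x * v x) = 0"
      using zero[OF test_function_primitive(1)[OF v]]
        DERIV_imp_deriv[OF test_function_primitive(2)[OF v]] by simp
    moreover have "(LINT x|leb. w x * v x) = (LINT x|leb. w x * \<theta> x) - d * (LINT x|leb. w x * \<eta> x)"
      using wint by (simp add: v_def algebra_simps)
    moreover have "(LINT x|leb. (w x - c) * \<theta> x) = (LINT x|leb. w x * \<theta> x) - c * (LINT x|leb. \<theta> x)"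
      using wint int by (simp add: algebra_simps)
    ultimately show ?thesis by (simp add: c_def d_def)
  qed
  then have "AE x in leb. w x - c = 0"
    by (intro AE_zero_if_orthogonal_to_test_functions Bochner_Integration.integrable_diff w
        finite_measure.integrable_const[OF finite_measure_leb])
  then show ?thesis by (intro exI[of _ c]) (auto elim: eventually_mono)
qed

section \<open>Weak derivatives in one dimension\<close>

lemma has_weak_deriv_1:
  "has_weak_deriv 1 ivl u g \<longleftrightarrow> u \<in> L2_space ivl \<and> g \<in> L2_space ivl \<and>
    (\<forall>\<phi>\<in>test_functions ivl. (LINT x|leb. u x * deriv \<phi> x) = - (LINT x|leb. g x * \<phi> x))"
  by (simp add: has_weak_deriv_def)

lemma has_weak_deriv_L2:
  assumes "has_weak_deriv k ivl u g" shows "u \<in> L2_space ivl" "g \<in> L2_space ivl"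
  using assms by (auto simp: has_weak_deriv_def)

lemma has_weak_deriv_0: "u \<in> L2_space ivl \<Longrightarrow> has_weak_deriv 0 ivl u u"
  by (simp add: has_weak_deriv_def)

lemma has_weak_deriv_Suc:
  assumes "has_weak_deriv n ivl u g" "has_weak_deriv 1 ivl g h"
  shows "has_weak_deriv (Suc n) ivl u h"
  unfolding has_weak_deriv_def
proof (intro conjI ballI)
  show "u \<in> L2_space ivl" "h \<in> L2_space ivl" using assms by (auto simp: has_weak_deriv_def)
  fix \<phi> assume \<phi>: "\<phi> \<in> test_functions ivl"
  have "(LINT x|leb. u x * (deriv ^^ Suc n) \<phi> x) = (LINT x|leb. u x * (deriv ^^ n) (deriv \<phi>) x)"
    by (simp add: funpow_swap1)
  also have "\<dots> = (-1) ^ n * (LINT x|leb. g x * deriv \<phi> x)"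
    using assms(1) test_function_deriv[OF \<phi>] by (simp add: has_weak_deriv_def)
  also have "\<dots> = (-1) ^ Suc n * (LINT x|leb. h x * \<phi> x)"
    using assms(2) \<phi> unfolding has_weak_deriv_1 by simp
  finally show "(LINT x|leb. u x * (deriv ^^ Suc n) \<phi> x) = (-1) ^ Suc n * (LINT x|leb. h x * \<phi> x)" .
qed

text \<open>
    \<^const>\<open>Sobolev_space\<close> provides the second weak derivative relative to the function itself; for iterating the
    first-order theory it has to be the first weak derivative of the first one.
\<close>

lemma has_weak_deriv_2D:
  assumes "has_weak_deriv 1 ivl u g" "has_weak_deriv 2 ivl u h"
  shows "has_weak_deriv 1 ivl g h"
  unfolding has_weak_deriv_1
proof (intro conjI ballI)
  show "g \<in> L2_space ivl" "h \<in> L2_space ivl" using assms by (auto simp: has_weak_deriv_def)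
  fix \<phi> assume \<phi>: "\<phi> \<in> test_functions ivl"
  have "(LINT x|leb. u x * deriv (deriv \<phi>) x) = - (LINT x|leb. g x * deriv \<phi> x)"
    using assms(1) test_function_deriv[OF \<phi>] unfolding has_weak_deriv_1 by blast
  moreover have "(LINT x|leb. u x * deriv (deriv \<phi>) x) = (LINT x|leb. h x * \<phi> x)"
    using assms(2) \<phi> by (simp add: has_weak_deriv_def numeral_2_eq_2)
  ultimately show "(LINT x|leb. g x * deriv \<phi> x) = - (LINT x|leb. h x * \<phi> x)" by simp
qed

lemma integral_test_deriv_zero:
  assumes "\<phi> \<in> test_functions ivl" shows "(LINT x|leb. deriv \<phi> x) = 0"
proof -
  have "\<phi> (-1) = 0" by (rule test_function_support[OF assms(1)]) auto
  then show ?thesis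
    using integral_leb_eq[OF L2_integrable[OF test_function_L2[OF test_function_deriv[OF assms]]]]
      integral_test_deriv[OF assms, of "-1"] by simp
qed

lemma continuous_on_primitive:
  "integrable leb g \<Longrightarrow> continuous_on {-1..1} (\<lambda>x. integral {-1..x} g :: real)"
  by (intro indefinite_integral_continuous_1 integrable_on_subinterval) auto

lemma has_weak_deriv_primitive:
  assumes g: "g \<in> L2_space ivl" and u: "u \<in> borel_measurable leb"
    and eq: "AE x in leb. u x = c + integral {-1..x} g"
  shows "has_weak_deriv 1 ivl u g"
  unfolding has_weak_deriv_1
proof (intro conjI ballI)
  have cont: "continuous_on {-1..1} (\<lambda>x. c + integral {-1..x} g)"
    by (intro continuous_intros continuous_on_primitive L2_integrable g)
  have "integrable leb (\<lambda>x. (c + integral {-1..x} g)\<^sup>2)"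
    using continuous_L2[OF cont] by (simp add: L2_space_def)
  moreover have "AE x in leb. (c + integral {-1..x} g)\<^sup>2 = (u x)\<^sup>2"
    using eq by eventually_elim simp
  ultimately show "u \<in> L2_space ivl"
    using u unfolding L2_space_def
    by (auto intro: integrable_cong_AE_imp)
  show "g \<in> L2_space ivl" by fact
  fix \<phi> assume \<phi>: "\<phi> \<in> test_functions ivl"
  have d: "deriv \<phi> \<in> test_functions ivl" by (rule test_function_deriv[OF \<phi>])
  have [measurable]: "deriv \<phi> \<in> borel_measurable leb" "u \<in> borel_measurable leb"
    using L2_measurable[OF test_function_L2[OF d]] u by auto
  have int1: "integrable leb (\<lambda>x. integral {-1..x} g * deriv \<phi> x)"
    by (intro L2_mult_integrable test_function_L2 d continuous_L2 continuous_on_primitive L2_integrable g)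
  have int2: "integrable leb (\<lambda>x. c * deriv \<phi> x)"
    by (intro integrable_mult_right L2_integrable test_function_L2 d)
  have "(LINT x|leb. u x * deriv \<phi> x) = (LINT x|leb. c * deriv \<phi> x + integral {-1..x} g * deriv \<phi> x)"
  proof (rule integral_cong_AE)
    show "AE x in leb. u x * deriv \<phi> x = c * deriv \<phi> x + integral {-1..x} g * deriv \<phi> x"
      using eq by eventually_elim (simp add: algebra_simps)
    show "(\<lambda>x. u x * deriv \<phi> x) \<in> borel_measurable leb" by measurable
    show "(\<lambda>x. c * deriv \<phi> x + integral {-1..x} g * deriv \<phi> x) \<in> borel_measurable leb"
      by (rule borel_measurable_integrable) (rule Bochner_Integration.integrable_add[OF int2 int1])
  qed
  also have "\<dots> = (LINT x|leb. integral {-1..x} g * deriv \<phi> x)"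
    using int1 int2 integral_test_deriv_zero[OF \<phi>]
    by (subst Bochner_Integration.integral_add) auto
  also have "\<dots> = - (LINT x|leb. g x * \<phi> x)"
    by (rule integration_by_parts_primitive[OF L2_integrable[OF g] \<phi>])
  finally show "(LINT x|leb. u x * deriv \<phi> x) = - (LINT x|leb. g x * \<phi> x)" .
qed

text \<open>
    The difference of \<open>u\<close> and a primitive of its weak derivative is orthogonal to all derivatives of test
    functions, hence constant.
\<close>

lemma weak_deriv_primitive_rep:
  assumes "has_weak_deriv 1 ivl u g"
  obtains c where "AE x in leb. u x = c + integral {-1..x} g"
proof -
  have u: "u \<in> L2_space ivl" and g: "g \<in> L2_space ivl" using assms by (auto simp: has_weak_deriv_def)
  have p: "(\<lambda>x. integral {-1..x} g) \<in> L2_space ivl"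
    by (intro continuous_L2 continuous_on_primitive L2_integrable g)
  have "\<exists>c. AE x in leb. u x - integral {-1..x} g = c"
  proof (rule constant_if_orthogonal_to_test_derivatives)
    show "integrable leb (\<lambda>x. u x - integral {-1..x} g)"
      by (intro Bochner_Integration.integrable_diff L2_integrable u p)
    fix \<phi> assume \<phi>: "\<phi> \<in> test_functions ivl"
    have d: "deriv \<phi> \<in> L2_space ivl" by (rule test_function_L2[OF test_function_deriv[OF \<phi>]])
    have "(LINT x|leb. (u x - integral {-1..x} g) * deriv \<phi> x) =
        (LINT x|leb. u x * deriv \<phi> x) - (LINT x|leb. integral {-1..x} g * deriv \<phi> x)"
      by (subst Bochner_Integration.integral_diff[symmetric])
        (auto intro!: L2_mult_integrable u p d simp: left_diff_distrib)
    also have "\<dots> = 0"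
      using assms \<phi> integration_by_parts_primitive[OF L2_integrable[OF g] \<phi>]
      unfolding has_weak_deriv_1 by simp
    finally show "(LINT x|leb. (u x - integral {-1..x} g) * deriv \<phi> x) = 0" .
  qed
  then obtain c where "AE x in leb. u x - integral {-1..x} g = c" by blast
  then have "AE x in leb. u x = c + integral {-1..x} g" by eventually_elim simp
  then show ?thesis by (rule that)
qed

lemma weak_deriv_unique:
  assumes "has_weak_deriv 1 ivl u g" "has_weak_deriv 1 ivl u h"
  shows "AE x in leb. g x = h x"
proof -
  have gh: "g \<in> L2_space ivl" "h \<in> L2_space ivl" using assms by (auto simp: has_weak_deriv_def)
  have "AE x in leb. g x - h x = 0"
  proof (rule AE_zero_if_orthogonal_to_test_functions)
    show "integrable leb (\<lambda>x. g x - h x)"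
      by (intro Bochner_Integration.integrable_diff L2_integrable gh)
    fix \<phi> assume \<phi>: "\<phi> \<in> test_functions ivl"
    have "(LINT x|leb. (g x - h x) * \<phi> x) = (LINT x|leb. g x * \<phi> x) - (LINT x|leb. h x * \<phi> x)"
      by (subst Bochner_Integration.integral_diff[symmetric])
        (auto intro!: L2_mult_integrable gh test_function_L2 \<phi> simp: left_diff_distrib)
    also have "\<dots> = 0" using assms \<phi> unfolding has_weak_deriv_1 by simp
    finally show "(LINT x|leb. (g x - h x) * \<phi> x) = 0" .
  qed
  then show ?thesis by eventually_elim simp
qed

lemma has_weak_deriv_weak_deriv:
  "has_weak_deriv 1 ivl u g \<Longrightarrow> has_weak_deriv 1 ivl u (weak_deriv ivl u)"
  unfolding weak_deriv_def by (rule someI[of "has_weak_deriv 1 ivl u"])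

lemma weak_deriv_eq:
  "has_weak_deriv 1 ivl u g \<Longrightarrow> AE x in leb. weak_deriv ivl u x = g x"
  using has_weak_deriv_weak_deriv weak_deriv_unique by blast

lemma has_weak_deriv_comb:
  assumes "has_weak_deriv 1 ivl u g" "has_weak_deriv 1 ivl v h"
  shows "has_weak_deriv 1 ivl (\<lambda>x. c * u x + d * v x) (\<lambda>x. c * g x + d * h x)"
proof -
  have L2: "u \<in> L2_space ivl" "g \<in> L2_space ivl" "v \<in> L2_space ivl" "h \<in> L2_space ivl"
    using assms by (auto simp: has_weak_deriv_def)
  have lin: "(LINT x|leb. (c * a x + d * b x) * \<phi> x) =
      c * (LINT x|leb. a x * \<phi> x) + d * (LINT x|leb. b x * \<phi> x)"
    if "a \<in> L2_space ivl" "b \<in> L2_space ivl" "\<phi> \<in> L2_space ivl" for a b \<phi>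
  proof -
    have "integrable leb (\<lambda>x. c * (a x * \<phi> x))" "integrable leb (\<lambda>x. d * (b x * \<phi> x))"
      using that by (intro integrable_mult_right L2_mult_integrable; simp)+
    from Bochner_Integration.integral_add[OF this] show ?thesis
      by (simp add: algebra_simps)
  qed
  show ?thesis
    unfolding has_weak_deriv_1
  proof (intro conjI ballI L2_comb L2)
    fix \<phi> assume \<phi>: "\<phi> \<in> test_functions ivl"
    then have "\<phi> \<in> L2_space ivl" "deriv \<phi> \<in> L2_space ivl"
      using test_function_L2 test_function_deriv by blast+
    then show "(LINT x|leb. (c * u x + d * v x) * deriv \<phi> x) = - (LINT x|leb. (c * g x + d * h x) * \<phi> x)"
      using assms \<phi> unfolding has_weak_deriv_1 by (simp add: lin L2)
  qed
qed

lemma has_weak_deriv_test_function: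
  assumes "\<phi> \<in> test_functions ivl" shows "has_weak_deriv 1 ivl \<phi> (deriv \<phi>)"
proof (rule has_weak_deriv_primitive)
  have "\<phi> x = 0 + integral {-1..x} (deriv \<phi>)" if "x \<in> space leb" for x
  proof -
    have "((deriv \<phi>) has_integral (\<phi> x - \<phi> (-1))) {-1..x}"
      by (rule fundamental_theorem_of_calculus)
        (use test_function_has_deriv[OF assms(1)] that in
          \<open>auto simp: has_real_derivative_iff_has_vector_derivative[symmetric] intro: has_field_derivative_at_within\<close>)
    moreover have "\<phi> (-1) = 0" by (rule test_function_support[OF assms(1)]) auto
    ultimately show ?thesis by (simp add: integral_unique)
  qed
  then show "AE x in leb. \<phi> x = 0 + integral {-1..x} (deriv \<phi>)" by (rule AE_I2)
qed (auto intro: test_function_L2 test_function_deriv L2_measurable assms)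

lemma Sobolev_1_iff: "u \<in> Sobolev_space 1 ivl \<longleftrightarrow> (\<exists>g. has_weak_deriv 1 ivl u g)"
proof
  assume "\<exists>g. has_weak_deriv 1 ivl u g"
  then obtain g where g: "has_weak_deriv 1 ivl u g" by blast
  then have "has_weak_deriv 0 ivl u u" by (auto intro: has_weak_deriv_0 simp: has_weak_deriv_def)
  then show "u \<in> Sobolev_space 1 ivl" using g by (auto simp: Sobolev_space_def le_Suc_eq)
qed (auto simp: Sobolev_space_def)

section \<open>Functions with zero boundary values\<close>

text \<open>
    The Cauchy-Schwarz inequality against the constant \<open>1\<close>, by expanding the square of the distance to the mean.
\<close>

lemma integral_square_bound:
  assumes "w \<in> L2_space ivl" shows "\<bar>LINT x|leb. w x\<bar> \<le> sqrt 2 * L2_norm ivl w"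
proof -
  \<comment> \<open>The mean of the function: the interval has length 2.\<close>
  define m where "m = (LINT x|leb. w x) / 2"
  have w2: "integrable leb (\<lambda>x. (w x)\<^sup>2)" using assms by (simp add: L2_space_def)
  have w: "integrable leb w" by (rule L2_integrable[OF assms])
  have const: "integrable leb (\<lambda>x. m\<^sup>2)" "(LINT x|leb. m\<^sup>2) = 2 * m\<^sup>2"
    by (auto simp: finite_measure.integrable_const[OF finite_measure_leb] measure_restrict_space)
  have "0 \<le> (LINT x|leb. (w x - m)\<^sup>2)" by simp
  also have "\<dots> = (LINT x|leb. ((w x)\<^sup>2 - 2 * m * w x) + m\<^sup>2)"
    by (simp add: power2_diff algebra_simps)
  also have "\<dots> = (LINT x|leb. (w x)\<^sup>2) - 2 * m * (LINT x|leb. w x) + 2 * m\<^sup>2"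
    using w w2 const by simp
  also have "\<dots> = (LINT x|leb. (w x)\<^sup>2) - (LINT x|leb. w x)\<^sup>2 / 2"
    by (simp add: m_def power2_eq_square)
  finally have "(LINT x|leb. w x)\<^sup>2 \<le> 2 * (LINT x|leb. (w x)\<^sup>2)" by simp
  then have "sqrt ((LINT x|leb. w x)\<^sup>2) \<le> sqrt (2 * (LINT x|leb. (w x)\<^sup>2))"
    by (rule real_sqrt_le_mono)
  then show ?thesis by (simp add: L2_norm_def real_sqrt_mult)
qed

lemma H10_has_weak_deriv: "y \<in> H10_space ivl \<Longrightarrow> has_weak_deriv 1 ivl y (weak_deriv ivl y)"
  using Sobolev_1_iff has_weak_deriv_weak_deriv by (auto simp: H10_space_def)

text \<open>
    The boundary condition enters the proof through this identity.  It holds for test functions and passes to the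
    limit in the \<open>H\<^sup>1\<close> norm.
\<close>

lemma H10_integral_weak_deriv:
  assumes y: "y \<in> H10_space ivl" shows "(LINT x|leb. weak_deriv ivl y x) = 0"
proof -
  obtain \<phi> where \<phi>: "\<And>n::nat. \<phi> n \<in> test_functions ivl"
    and lim: "(\<lambda>n. H1_norm ivl (\<lambda>x. y x - \<phi> n x)) \<longlonglongrightarrow> 0"
    using y by (auto simp: H10_space_def)
  have "\<bar>LINT x|leb. weak_deriv ivl y x\<bar> \<le> sqrt 2 * H1_norm ivl (\<lambda>x. y x - \<phi> n x)" for n
  proof -
    define e where "e = weak_deriv ivl (\<lambda>x. y x - \<phi> n x)"
    have d: "has_weak_deriv 1 ivl (\<lambda>x. y x - \<phi> n x) (\<lambda>x. weak_deriv ivl y x - deriv (\<phi> n) x)"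
      using has_weak_deriv_comb[OF H10_has_weak_deriv[OF y] has_weak_deriv_test_function[OF \<phi>], of 1 "-1"]
      by simp
    have L2: "e \<in> L2_space ivl" "weak_deriv ivl y \<in> L2_space ivl" "deriv (\<phi> n) \<in> L2_space ivl"
      unfolding e_def
      by (rule has_weak_deriv_L2[OF has_weak_deriv_weak_deriv[OF d]]
          has_weak_deriv_L2[OF H10_has_weak_deriv[OF y]]
          has_weak_deriv_L2[OF has_weak_deriv_test_function[OF \<phi>]])+
    have "(LINT x|leb. e x) = (LINT x|leb. weak_deriv ivl y x - deriv (\<phi> n) x)"
      by (rule integral_cong_AE)
        (use weak_deriv_eq[OF d] L2 in \<open>auto simp: e_def intro!: L2_measurable L2_diff\<close>)
    also have "\<dots> = (LINT x|leb. weak_deriv ivl y x)"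
      using L2 L2_integrable integral_test_deriv_zero[OF \<phi>] by simp
    finally have "\<bar>LINT x|leb. weak_deriv ivl y x\<bar> \<le> sqrt 2 * L2_norm ivl e"
      using integral_square_bound[OF L2(1)] by simp
    also have "\<dots> \<le> sqrt 2 * H1_norm ivl (\<lambda>x. y x - \<phi> n x)"
      unfolding H1_norm_def e_def[symmetric] by (intro mult_left_mono) (auto intro: real_le_rsqrt)
    finally show ?thesis .
  qed
  then have "\<bar>LINT x|leb. weak_deriv ivl y x\<bar> \<le> sqrt 2 * 0"
    by (intro LIMSEQ_le_const[OF tendsto_mult_left[OF lim]]) auto
  then show ?thesis by simp
qed

lemma H10_add_test_function:
  assumes y: "y \<in> H10_space ivl" and \<Phi>: "\<Phi> \<in> test_functions ivl"
  shows "(\<lambda>x. y x + t * \<Phi> x) \<in> H10_space ivl"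
proof -
  obtain \<phi> where \<phi>: "\<And>n::nat. \<phi> n \<in> test_functions ivl"
    and lim: "(\<lambda>n. H1_norm ivl (\<lambda>x. y x - \<phi> n x)) \<longlonglongrightarrow> 0"
    using y by (auto simp: H10_space_def)
  have "has_weak_deriv 1 ivl (\<lambda>x. y x + t * \<Phi> x) (\<lambda>x. weak_deriv ivl y x + t * deriv \<Phi> x)"
    using has_weak_deriv_comb[OF H10_has_weak_deriv[OF y] has_weak_deriv_test_function[OF \<Phi>], of 1 t]
    by simp
  then have "(\<lambda>x. y x + t * \<Phi> x) \<in> Sobolev_space 1 ivl" using Sobolev_1_iff by blast
  moreover have "(\<lambda>x. \<phi> n x + t * \<Phi> x) \<in> test_functions ivl" for n
    using test_function_comb[OF \<phi> \<Phi>, of 1 _ t] by simp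
  ultimately show ?thesis
    unfolding H10_space_def
    by (intro CollectI conjI exI[of _ "\<lambda>n x. \<phi> n x + t * \<Phi> x"]) (use lim in auto)
qed

lemma test_function_H10:
  assumes "\<phi> \<in> test_functions ivl" shows "\<phi> \<in> H10_space ivl"
proof -
  have "has_weak_deriv 1 ivl (\<lambda>x. 0) (\<lambda>x. 0)"
    using has_weak_deriv_comb[OF has_weak_deriv_test_function[OF assms] has_weak_deriv_test_function[OF assms], of 0 0]
    by simp
  from weak_deriv_eq[OF this] has_weak_deriv_weak_deriv[OF this]
  have "(LINT x|leb. (weak_deriv ivl (\<lambda>x. 0) x)\<^sup>2) = (LINT x|leb. 0)"
    by (intro integral_cong_AE borel_measurable_power)
      (auto dest!: has_weak_deriv_L2(2) intro!: L2_measurable elim!: eventually_mono)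
  then have "H1_norm ivl (\<lambda>x. 0) = 0" by (simp add: H1_norm_def L2_norm_def)
  moreover have "\<phi> \<in> Sobolev_space 1 ivl"
    using has_weak_deriv_test_function[OF assms] Sobolev_1_iff by blast
  ultimately show ?thesis
    unfolding H10_space_def by (intro CollectI conjI exI[of _ "\<lambda>n. \<phi>"]) (use assms in auto)
qed

section \<open>Perturbation of a minimizer by test functions\<close>

text \<open>
    Test functions are legitimate in the state equation, which then becomes the definition of the weak
    derivative of \<open>y'\<close>.
\<close>

lemma admissible_second_weak_deriv:
  assumes adm: "(y, u) \<in> admissible ivl f \<psi>" and f: "f \<in> L2_space ivl"
  shows "has_weak_deriv 1 ivl (weak_deriv ivl y) (\<lambda>x. - (u x + f x))"
  unfolding has_weak_deriv_1
proof (intro conjI ballI)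
  have y: "y \<in> H10_space ivl" and u: "u \<in> L2_space ivl" using adm by (auto simp: admissible_def)
  show dy: "weak_deriv ivl y \<in> L2_space ivl"
    by (rule has_weak_deriv_L2[OF H10_has_weak_deriv[OF y]])
  show "(\<lambda>x. - (u x + f x)) \<in> L2_space ivl" using L2_comb[OF u f, of "-1" "-1"] by simp
  fix \<phi> assume \<phi>: "\<phi> \<in> test_functions ivl"
  have d: "has_weak_deriv 1 ivl \<phi> (deriv \<phi>)" by (rule has_weak_deriv_test_function[OF \<phi>])
  have "(LINT x|leb. weak_deriv ivl y x * deriv \<phi> x) = (LINT x|leb. weak_deriv ivl y x * weak_deriv ivl \<phi> x)"
    using weak_deriv_eq[OF d] has_weak_deriv_weak_deriv[OF d] d dy
    by (intro integral_cong_AE borel_measurable_times L2_measurable)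
      (auto dest: has_weak_deriv_L2 elim!: eventually_mono)
  also have "\<dots> = (LINT x|leb. (u x + f x) * \<phi> x)"
    using adm test_function_H10[OF \<phi>] by (simp add: admissible_def)
  finally show "(LINT x|leb. weak_deriv ivl y x * deriv \<phi> x) = - (LINT x|leb. - (u x + f x) * \<phi> x)"
    by (simp add: algebra_simps flip: Bochner_Integration.integral_minus)
qed

text \<open>
    Adding \<open>t * \<Phi>\<close> to the state is compensated in the state equation by subtracting \<open>t * \<Phi>''\<close> from the control.
\<close>

lemma admissible_perturb:
  assumes adm: "(y, u) \<in> admissible ivl f \<psi>" and f: "f \<in> L2_space ivl"
    and \<Phi>: "\<Phi> \<in> test_functions ivl"
    and le: "AE x in leb. weak_deriv ivl y x + t * deriv \<Phi> x \<le> \<psi> x"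
  shows "(\<lambda>x. y x + t * \<Phi> x, \<lambda>x. u x - t * deriv (deriv \<Phi>) x) \<in> admissible ivl f \<psi>"
proof -
  have y: "y \<in> H10_space ivl" and u: "u \<in> L2_space ivl" using adm by (auto simp: admissible_def)
  have d1: "deriv \<Phi> \<in> test_functions ivl" and d2: "deriv (deriv \<Phi>) \<in> test_functions ivl"
    using \<Phi> test_function_deriv by blast+
  note dL2 = test_function_L2[OF d1] test_function_L2[OF d2]
  have d: "has_weak_deriv 1 ivl (\<lambda>x. y x + t * \<Phi> x) (\<lambda>x. weak_deriv ivl y x + t * deriv \<Phi> x)"
    using has_weak_deriv_comb[OF H10_has_weak_deriv[OF y] has_weak_deriv_test_function[OF \<Phi>], of 1 t]
    by simp
  have yL2: "weak_deriv ivl y \<in> L2_space ivl"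
    by (rule has_weak_deriv_L2[OF H10_has_weak_deriv[OF y]])
  show ?thesis
    unfolding admissible_def
  proof (intro CollectI case_prodI conjI ballI)
    show "(\<lambda>x. y x + t * \<Phi> x) \<in> H10_space ivl" by (rule H10_add_test_function[OF y \<Phi>])
    show "(\<lambda>x. u x - t * deriv (deriv \<Phi>) x) \<in> L2_space ivl"
      using L2_comb[OF u dL2(2), of 1 "-t"] by simp
    show "AE x in leb. weak_deriv ivl (\<lambda>x. y x + t * \<Phi> x) x \<le> \<psi> x"
      using weak_deriv_eq[OF d] le by eventually_elim simp
    fix z assume z: "z \<in> H10_space ivl"
    have dz: "has_weak_deriv 1 ivl z (weak_deriv ivl z)" by (rule H10_has_weak_deriv[OF z])
    note zL2 = has_weak_deriv_L2[OF dz]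
    have "(LINT x|leb. weak_deriv ivl (\<lambda>x. y x + t * \<Phi> x) x * weak_deriv ivl z x) =
        (LINT x|leb. (weak_deriv ivl y x + t * deriv \<Phi> x) * weak_deriv ivl z x)"
      using weak_deriv_eq[OF d] has_weak_deriv_weak_deriv[OF d] d zL2
      by (intro integral_cong_AE borel_measurable_times L2_measurable)
        (auto dest: has_weak_deriv_L2 elim!: eventually_mono)
    also have "\<dots> = (LINT x|leb. weak_deriv ivl y x * weak_deriv ivl z x + t * (weak_deriv ivl z x * deriv \<Phi> x))"
      by (simp add: algebra_simps)
    also have "\<dots> = (LINT x|leb. weak_deriv ivl y x * weak_deriv ivl z x) +
        t * (LINT x|leb. weak_deriv ivl z x * deriv \<Phi> x)"
      by (subst Bochner_Integration.integral_add)
        (auto intro!: integrable_mult_right L2_mult_integrable yL2 zL2 dL2)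
    also have "(LINT x|leb. weak_deriv ivl y x * weak_deriv ivl z x) = (LINT x|leb. (u x + f x) * z x)"
      using adm z by (simp add: admissible_def)
    also have "(LINT x|leb. weak_deriv ivl z x * deriv \<Phi> x) = - (LINT x|leb. z x * deriv (deriv \<Phi>) x)"
      using dz d1 unfolding has_weak_deriv_1 by simp
    also have "(LINT x|leb. (u x + f x) * z x) + t * - (LINT x|leb. z x * deriv (deriv \<Phi>) x) =
        (LINT x|leb. (u x + f x) * z x - t * (z x * deriv (deriv \<Phi>) x))"
      using L2_mult_integrable[OF zL2(1) dL2(2)] L2_mult_integrable[OF L2_comb[OF u f, of 1 1] zL2(1)]
      by simp
    also have "\<dots> = (LINT x|leb. (u x - t * deriv (deriv \<Phi>) x + f x) * z x)"
      by (simp add: algebra_simps)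
    finally show "(LINT x|leb. weak_deriv ivl (\<lambda>x. y x + t * \<Phi> x) x * weak_deriv ivl z x) = \<dots>" .
  qed
qed

lemma quadratic_nonneg_slope:
  fixes A B \<epsilon> :: real
  assumes "\<epsilon> > 0" "\<And>t. 0 < t \<Longrightarrow> t \<le> \<epsilon> \<Longrightarrow> 0 \<le> t * A + t\<^sup>2 * B"
  shows "A \<ge> 0"
proof (rule ccontr)
  assume A: "\<not> A \<ge> 0"
  \<comment> \<open>A step so small that the quadratic term compensates at most half of a negative linear one.\<close>
  define t where "t = min \<epsilon> (- A / (2 * (\<bar>B\<bar> + 1)))"
  have "- A / (2 * (\<bar>B\<bar> + 1)) > 0" using A by (intro divide_pos_pos) auto
  then have t: "0 < t" "t \<le> \<epsilon>" using assms(1) by (auto simp: t_def)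
  have "t * \<bar>B\<bar> \<le> - A / (2 * (\<bar>B\<bar> + 1)) * (\<bar>B\<bar> + 1)"
    by (rule mult_mono) (use A \<open>- A / (2 * (\<bar>B\<bar> + 1)) > 0\<close> in \<open>simp_all add: t_def\<close>)
  also have "\<dots> = - A / 2" by (simp add: field_simps)
  finally have "t * B \<le> - A / 2" using t by (smt (verit) mult_left_mono abs_ge_self)
  then have "A + t * B < 0" using A by simp
  then have "t * (A + t * B) < 0" using t by (simp add: mult_pos_neg)
  then show False using assms(2)[OF t] by (simp add: algebra_simps power2_eq_square)
qed

text \<open>
    The cost is quadratic along the segment \<open>t \<mapsto> (y + t \<Phi>, u - t \<Phi>'')\<close>, which is feasible on \<open>[0, \<epsilon>]\<close>
    by convexity of the constraint; the conclusion says that its slope at \<open>t = 0\<close> is nonnegative.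
\<close>

lemma optimality_condition:
  assumes opt: "is_arg_min (cost ivl \<beta> y_d) (\<lambda>p. p \<in> admissible ivl f \<psi>) (y, u)"
    and f: "f \<in> L2_space ivl" and yd: "y_d \<in> L2_space ivl"
    and \<Phi>: "\<Phi> \<in> test_functions ivl" and "\<epsilon> > 0"
    and le: "AE x in leb. weak_deriv ivl y x + \<epsilon> * deriv \<Phi> x \<le> \<psi> x"
  shows "0 \<le> (LINT x|leb. (y x - y_d x) * \<Phi> x) - \<beta> * (LINT x|leb. u x * deriv (deriv \<Phi>) x)"
proof -
  have adm: "(y, u) \<in> admissible ivl f \<psi>" using opt by (simp add: is_arg_min_def)
  then have y: "y \<in> H10_space ivl" and u: "u \<in> L2_space ivl"
    and le0: "AE x in leb. weak_deriv ivl y x \<le> \<psi> x" by (auto simp: admissible_def)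
  have yL2: "(\<lambda>x. y x - y_d x) \<in> L2_space ivl"
    by (rule L2_diff[OF has_weak_deriv_L2(1)[OF H10_has_weak_deriv[OF y]] yd])
  have \<Phi>L2: "\<Phi> \<in> L2_space ivl" "deriv (deriv \<Phi>) \<in> L2_space ivl"
    using \<Phi> test_function_L2 test_function_deriv by blast+
  define d where "d x = deriv (deriv \<Phi>) x" for x
  have dL2: "d \<in> L2_space ivl" using \<Phi>L2 by (simp add: d_def[abs_def])
  have sq: "(L2_norm ivl v)\<^sup>2 = (LINT x|leb. (v x)\<^sup>2)" for v by (simp add: L2_norm_def)
  have expand: "(LINT x|leb. (a x + t * b x)\<^sup>2) =
      (LINT x|leb. (a x)\<^sup>2) + 2 * t * (LINT x|leb. a x * b x) + t\<^sup>2 * (LINT x|leb. (b x)\<^sup>2)"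
    if "a \<in> L2_space ivl" "b \<in> L2_space ivl" for a b t
  proof -
    have "(LINT x|leb. (a x + t * b x)\<^sup>2) =
        (LINT x|leb. (a x)\<^sup>2 + 2 * t * (a x * b x) + t\<^sup>2 * (b x)\<^sup>2)"
      by (simp add: power2_eq_square algebra_simps)
    also have "\<dots> = (LINT x|leb. (a x)\<^sup>2) + 2 * t * (LINT x|leb. a x * b x) + t\<^sup>2 * (LINT x|leb. (b x)\<^sup>2)"
      using that L2_mult_integrable[OF that] by (simp add: L2_space_def)
    finally show ?thesis .
  qed
  show ?thesis
  proof (rule quadratic_nonneg_slope[OF \<open>\<epsilon> > 0\<close>])
    fix t :: real assume t: "0 < t" "t \<le> \<epsilon>"
    have "AE x in leb. weak_deriv ivl y x + t * deriv \<Phi> x \<le> \<psi> x"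
      using le le0
    proof eventually_elim
      case (elim x)
      have "t * deriv \<Phi> x \<le> max 0 (\<epsilon> * deriv \<Phi> x)"
        using t by (cases "deriv \<Phi> x \<ge> 0") (auto simp: mult_right_mono le_max_iff_disj mult_nonneg_nonpos)
      with elim show ?case by (auto simp: max_def split: if_splits)
    qed
    from admissible_perturb[OF adm f \<Phi> this]
    have "cost ivl \<beta> y_d (y, u) \<le> cost ivl \<beta> y_d (\<lambda>x. y x + t * \<Phi> x, \<lambda>x. u x - t * d x)"
      using opt by (force simp: is_arg_min_def d_def not_less)
    moreover have "(LINT x|leb. (y x + t * \<Phi> x - y_d x)\<^sup>2) = (LINT x|leb. (y x - y_d x + t * \<Phi> x)\<^sup>2)"
      by (simp add: algebra_simps)
    moreover have "(LINT x|leb. (u x - t * d x)\<^sup>2) = (LINT x|leb. (u x + (-t) * d x)\<^sup>2)" by simp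
    ultimately have "0 \<le> 2 * t * (LINT x|leb. (y x - y_d x) * \<Phi> x) + t\<^sup>2 * (LINT x|leb. (\<Phi> x)\<^sup>2) +
        \<beta> * (2 * (-t) * (LINT x|leb. u x * d x) + t\<^sup>2 * (LINT x|leb. (d x)\<^sup>2))"
      unfolding cost_def case_prod_conv sq
      by (simp only: expand[OF yL2 \<Phi>L2(1)] expand[OF u dL2]) (simp add: algebra_simps)
    then show "0 \<le> t * ((LINT x|leb. (y x - y_d x) * \<Phi> x) - \<beta> * (LINT x|leb. u x * deriv (deriv \<Phi>) x)) +
        t\<^sup>2 * (((LINT x|leb. (\<Phi> x)\<^sup>2) + \<beta> * (LINT x|leb. (d x)\<^sup>2)) / 2)"
      unfolding d_def by (simp add: algebra_simps add_divide_distrib)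
  qed
qed

section \<open>Monotone averages and the Lagrange multiplier\<close>

text \<open>
    Nonnegative test functions whose derivatives approximate the normalized indicator of \<open>{a..b}\<close> minus that of
    \<open>{c..d}\<close>.  They turn inequalities tested with \<open>\<phi>'\<close> into inequalities between averages.
\<close>

lemma trapezoid_test_functions:
  assumes W: "integrable leb W" and abcd: "-1 < a" "a < b" "b \<le> c" "c < d" "d < 1"
  obtains \<phi> :: "nat \<Rightarrow> real \<Rightarrow> real" where "\<And>n. \<phi> n \<in> test_functions ivl"
    "\<And>n x. x \<in> ivl \<Longrightarrow> 0 \<le> \<phi> n x" "\<And>n x. x \<in> ivl \<Longrightarrow> x \<notin> {a..d} \<Longrightarrow> \<phi> n x = 0"
    "(\<lambda>n. LINT x|leb. W x * deriv (\<phi> n) x) \<longlonglongrightarrow> integral {a..b} W / (b - a) - integral {c..d} W / (d - c)"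
proof -
  have ab: "-1 < a" "a < b" "b < 1" and cd: "-1 < c" "c < d" "d < 1" using abcd by auto
  define p q where "p n = (LINT x|leb. bump_on a b n x)" and "q n = (LINT x|leb. bump_on c d n x)" for n
  have lim: "p \<longlonglongrightarrow> b - a" "q \<longlonglongrightarrow> d - c"
    using bump_on_mass[OF ab] bump_on_mass[OF cd] by (simp_all add: p_def[abs_def] q_def[abs_def])
  have "eventually (\<lambda>n. p n > 0 \<and> q n > 0) sequentially"
    using order_tendstoD(1)[OF lim(1), of 0] order_tendstoD(1)[OF lim(2), of 0] ab cd
    by (auto intro: eventually_conj)
  then obtain N where N: "\<And>n. n \<ge> N \<Longrightarrow> p n > 0 \<and> q n > 0"
    unfolding eventually_sequentially by blast
  \<comment> \<open>Both bumps are normalized to mass one so that the difference has mean zero; the shift by \<open>N\<close> makes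
  both masses positive.\<close>
  define v where "v n x = 1 / p (n + N) * bump_on a b (n + N) x + (- 1 / q (n + N)) * bump_on c d (n + N) x" for n x
  have v_test: "v n \<in> test_functions ivl" for n
    unfolding v_def[abs_def] by (intro test_function_comb bump_on_test ab cd)
  have pos: "p (n + N) > 0" "q (n + N) > 0" for n using N[of "n + N"] by auto
  have mean0: "(LINT x|leb. v n x) = 0" for n
  proof -
    have "(LINT x|leb. v n x) = 1 / p (n + N) * p (n + N) + (- 1 / q (n + N)) * q (n + N)"
      unfolding v_def p_def q_def
      using L2_integrable[OF test_function_L2[OF bump_on_test[OF ab]]]
        L2_integrable[OF test_function_L2[OF bump_on_test[OF cd]]]
      by (subst Bochner_Integration.integral_add) (auto intro!: integrable_mult_right)
    then show ?thesis using pos[of n] by simp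
  qed
  have v_nonneg: "v n x \<ge> 0" if "x \<le> c" for n x
    using bump_on_range[of a b "n + N" x] bump_on_outside[OF cd(2), of x "n + N"] pos[of n] that
    by (simp add: v_def)
  have v_nonpos: "v n x \<le> 0" if "x \<ge> b" for n x
    using bump_on_range[of c d "n + N" x] bump_on_outside[OF ab(2), of x "n + N"] pos[of n] that
    by (simp add: v_def)
  have v_zero: "v n x = 0" if "x \<notin> {a..d}" for n x
    using bump_on_outside[OF cd(2), of x "n + N"] bump_on_outside[OF ab(2), of x "n + N"] that abcd
    by (auto simp: v_def)
  have v_int: "v n integrable_on {x..y}" for n x y
    by (intro integrable_continuous_real test_function_continuous_on v_test)
  have tail: "integral {-1..x} (v n) = - integral {x..1} (v n)" if "x \<in> ivl" for n x
  proof -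
    have "integral {-1..x} (v n) + integral {x..1} (v n) = integral {-1..1} (v n)"
      by (rule Henstock_Kurzweil_Integration.integral_combine) (use that v_int in auto)
    then show ?thesis
      using mean0[of n] integral_leb_eq[OF L2_integrable[OF test_function_L2[OF v_test[of n]]]] by simp
  qed
  define \<phi> where "\<phi> n x = integral {-1..x} (v n)" for n x
  have deriv: "deriv (\<phi> n) = v n" for n
    unfolding \<phi>_def[abs_def]
    by (rule ext, rule DERIV_imp_deriv, rule test_function_primitive(2)[OF v_test mean0])
  show ?thesis
  proof (rule that[of \<phi>])
    show "\<phi> n \<in> test_functions ivl" for n
      unfolding \<phi>_def[abs_def] by (rule test_function_primitive(1)[OF v_test mean0])
    show "0 \<le> \<phi> n x" if x: "x \<in> ivl" for n x
    proof (cases "x \<le> c")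
      case True
      then show ?thesis unfolding \<phi>_def
        by (intro Henstock_Kurzweil_Integration.integral_nonneg v_int) (auto intro: v_nonneg)
    next
      case False
      have "integral {x..1} (v n) \<le> integral {x..1} (\<lambda>x. 0)"
        by (rule integral_le) (use v_int False abcd in \<open>auto intro!: v_nonpos\<close>)
      then show ?thesis unfolding \<phi>_def tail[OF x] by simp
    qed
    show "\<phi> n x = 0" if x: "x \<in> ivl" "x \<notin> {a..d}" for n x
    proof (cases "x < a")
      case True
      have "integral {-1..x} (v n) = integral {-1..x} (\<lambda>x. 0)"
        by (intro Henstock_Kurzweil_Integration.integral_cong v_zero) (use True in auto)
      then show ?thesis by (simp add: \<phi>_def)
    next
      case False
      have "integral {x..1} (v n) = integral {x..1} (\<lambda>x. 0)"
        by (intro Henstock_Kurzweil_Integration.integral_cong v_zero) (use False x in auto)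
      then show ?thesis using tail[OF x(1)] by (simp add: \<phi>_def)
    qed
    have eq: "(LINT x|leb. W x * deriv (\<phi> n) x) =
        (LINT x|leb. W x * bump_on a b (n + N) x) / p (n + N) - (LINT x|leb. W x * bump_on c d (n + N) x) / q (n + N)" for n
    proof -
      have i: "integrable leb (\<lambda>x. W x * bump_on a b (n + N) x)" "integrable leb (\<lambda>x. W x * bump_on c d (n + N) x)"
        by (intro integrable_mult_continuous W test_function_continuous_on bump_on_test ab cd)+
      have "(LINT x|leb. W x * v n x) =
        (LINT x|leb. (W x * bump_on a b (n + N) x) / p (n + N) - (W x * bump_on c d (n + N) x) / q (n + N))"
        by (simp add: v_def algebra_simps)
      also have "\<dots> = (LINT x|leb. W x * bump_on a b (n + N) x) / p (n + N) - (LINT x|leb. W x * bump_on c d (n + N) x) / q (n + N)"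
        using i by simp
      finally show ?thesis unfolding deriv .
    qed
    have "(\<lambda>n. (LINT x|leb. W x * bump_on a b n x) / p n - (LINT x|leb. W x * bump_on c d n x) / q n)
        \<longlonglongrightarrow> integral {a..b} W / (b - a) - integral {c..d} W / (d - c)"
      by (intro tendsto_intros bump_on_limit W ab cd lim) (use ab cd in auto)
    then show "(\<lambda>n. LINT x|leb. W x * deriv (\<phi> n) x) \<longlonglongrightarrow> integral {a..b} W / (b - a) - integral {c..d} W / (d - c)"
      unfolding eq by (rule LIMSEQ_ignore_initial_segment)
  qed
qed

text \<open>
    Averages serve as a substitute for pointwise values: for a function with nondecreasing distribution they
    are nondecreasing, with no need to choose a monotone representative.
\<close>

lemma averages_mono:
  assumes W: "integrable leb W" and abcd: "-1 < a" "a < b" "b \<le> c" "c < d" "d < 1"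
    and le: "\<And>\<phi>. \<phi> \<in> test_functions ivl \<Longrightarrow> (\<And>x. x \<in> ivl \<Longrightarrow> 0 \<le> \<phi> x) \<Longrightarrow>
      (\<And>x. x \<in> ivl \<Longrightarrow> x \<notin> {a..d} \<Longrightarrow> \<phi> x = 0) \<Longrightarrow> (LINT x|leb. W x * deriv \<phi> x) \<le> 0"
  shows "integral {a..b} W / (b - a) \<le> integral {c..d} W / (d - c)"
proof -
  obtain \<phi> :: "nat \<Rightarrow> real \<Rightarrow> real" where \<phi>: "\<And>n. \<phi> n \<in> test_functions ivl"
    "\<And>n x. x \<in> ivl \<Longrightarrow> 0 \<le> \<phi> n x" "\<And>n x. x \<in> ivl \<Longrightarrow> x \<notin> {a..d} \<Longrightarrow> \<phi> n x = 0"
    "(\<lambda>n. LINT x|leb. W x * deriv (\<phi> n) x) \<longlonglongrightarrow> integral {a..b} W / (b - a) - integral {c..d} W / (d - c)"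
    using trapezoid_test_functions[OF W abcd] by blast
  have "integral {a..b} W / (b - a) - integral {c..d} W / (d - c) \<le> 0"
    by (rule LIMSEQ_le_const2[OF \<phi>(4)]) (use le[OF \<phi>(1,2,3)] in auto)
  then show ?thesis by simp
qed

lemma averages_antimono:
  assumes W: "integrable leb W" and abcd: "-1 < a" "a < b" "b \<le> c" "c < d" "d < 1"
    and le: "\<And>\<phi>. \<phi> \<in> test_functions ivl \<Longrightarrow> (\<And>x. x \<in> ivl \<Longrightarrow> 0 \<le> \<phi> x) \<Longrightarrow>
      (\<And>x. x \<in> ivl \<Longrightarrow> x \<notin> {a..d} \<Longrightarrow> \<phi> x = 0) \<Longrightarrow> 0 \<le> (LINT x|leb. W x * deriv \<phi> x)"
  shows "integral {c..d} W / (d - c) \<le> integral {a..b} W / (b - a)"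
proof -
  have "integral {a..b} (\<lambda>x. - W x) / (b - a) \<le> integral {c..d} (\<lambda>x. - W x) / (d - c)"
    by (rule averages_mono) (use W abcd le in auto)
  then show ?thesis by (simp add: divide_minus_left)
qed

lemma has_weak_deriv_id: "has_weak_deriv 1 ivl (\<lambda>x. x) (\<lambda>x. 1)"
  by (rule has_weak_deriv_primitive[OF L2_one, of _ "-1"])
    (auto intro!: continuous_on_measurable_leb AE_I2)

lemma integral_test_function_by_parts:
  assumes "\<phi> \<in> test_functions ivl" shows "(LINT x|leb. \<phi> x) = - (LINT x|leb. x * deriv \<phi> x)"
  using has_weak_deriv_id assms unfolding has_weak_deriv_1 by simp

text \<open>
    Only directions \<open>V\<close> of mean zero may be tested.  Near \<open>x0\<close> there is room for a bump \<open>\<eta>\<close> of mass one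
    of either sign, so any \<open>\<phi>\<close> can be corrected to mean zero by a multiple of \<open>\<eta>\<close>.  The price of the correction is linear in
    the mean of \<open>\<phi>\<close>, and after integration by parts it is the linear term \<open>l * x\<close>.
\<close>

lemma multiplier:
  fixes s :: "real \<Rightarrow> real"
  assumes W: "integrable leb W" and x0: "x0 \<in> ivl" "s x0 > 0" and s: "continuous_on ivl s"
    and var: "\<And>V \<delta>. V \<in> test_functions ivl \<Longrightarrow> (LINT x|leb. V x) = 0 \<Longrightarrow> \<delta> > 0 \<Longrightarrow>
      (\<And>x. x \<in> ivl \<Longrightarrow> V x > 0 \<Longrightarrow> \<delta> \<le> s x) \<Longrightarrow> 0 \<le> (LINT x|leb. W x * deriv V x)"
  shows "\<exists>l. (\<forall>\<phi>\<in>test_functions ivl. (\<forall>x\<in>ivl. 0 \<le> \<phi> x) \<longrightarrow>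
        (LINT x|leb. (W x - l * x) * deriv \<phi> x) \<le> 0) \<and>
      (\<forall>\<phi>\<in>test_functions ivl. \<forall>\<delta>>0. (\<forall>x\<in>ivl. 0 \<le> \<phi> x \<and> (\<phi> x > 0 \<longrightarrow> \<delta> \<le> s x)) \<longrightarrow>
        0 \<le> (LINT x|leb. (W x - l * x) * deriv \<phi> x))"
proof -
  have "open {y \<in> ivl. s y > s x0 / 2}"
    using continuous_open_preimage[OF s open_greaterThanLessThan open_greaterThan[of "s x0 / 2"]]
    by (simp add: vimage_def Int_def conj_commute)
  then obtain e where e: "e > 0" "cball x0 e \<subseteq> {y \<in> ivl. s y > s x0 / 2}"
    using x0 unfolding open_contains_cball by force
  have e': "y \<in> ivl \<and> s y > s x0 / 2" if "\<bar>y - x0\<bar> \<le> e" for y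
    using subsetD[OF e(2), of y] that by (auto simp: dist_real_def abs_minus_commute)
  obtain \<eta> where \<eta>: "\<eta> \<in> test_functions ivl" "\<And>x. \<eta> x \<ge> 0" "\<And>x. x \<notin> {x0 - e<..<x0 + e} \<Longrightarrow> \<eta> x = 0"
    "(LINT x|leb. \<eta> x) = 1"
    by (rule positive_bump_exists[of "x0 - e" "x0 + e"]) (use e(1) e'[of "x0 - e"] e'[of "x0 + e"] in auto)
  have \<eta>_pos: "s x0 / 2 \<le> s x" if "x \<in> ivl" "\<eta> x > 0" for x
      proof -
    have "x \<in> {x0 - e<..<x0 + e}" using \<eta>(3)[of x] that by force
    then have "\<bar>x - x0\<bar> \<le> e" by auto
    then show ?thesis using e'[of x] by simp
  qed
  define l where "l = - (LINT x|leb. W x * deriv \<eta> x)"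
  have int: "integrable leb (\<lambda>x. W x * deriv \<phi> x)" "integrable leb (\<lambda>x. x * deriv \<phi> x)" "integrable leb \<phi>"
    if "\<phi> \<in> test_functions ivl" for \<phi>
  proof -
    have d: "deriv \<phi> \<in> test_functions ivl" by (rule test_function_deriv[OF that])
    show "integrable leb (\<lambda>x. W x * deriv \<phi> x)"
      by (intro integrable_mult_continuous W test_function_continuous_on d)
    show "integrable leb (\<lambda>x. x * deriv \<phi> x)"
      by (intro integrable_mult_continuous test_function_continuous_on d L2_integrable
          has_weak_deriv_L2(1)[OF has_weak_deriv_id])
    show "integrable leb \<phi>" by (intro L2_integrable test_function_L2 that)
  qed
  have key: "(LINT x|leb. (W x - l * x) * deriv \<phi> x) =
      (LINT x|leb. W x * deriv \<phi> x) - (LINT x|leb. \<phi> x) * (LINT x|leb. W x * deriv \<eta> x)"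
    if \<phi>: "\<phi> \<in> test_functions ivl" for \<phi>
  proof -
    have "(LINT x|leb. (W x - l * x) * deriv \<phi> x) = (LINT x|leb. W x * deriv \<phi> x - l * (x * deriv \<phi> x))"
      by (simp add: algebra_simps)
    also have "\<dots> = (LINT x|leb. W x * deriv \<phi> x) - l * (LINT x|leb. x * deriv \<phi> x)"
      using int[OF \<phi>] by simp
    finally show ?thesis using integral_test_function_by_parts[OF \<phi>] by (simp add: l_def)
  qed
  have corrected: "(LINT x|leb. W x * deriv (\<lambda>x. c * \<phi> x + d * \<eta> x) x) =
      c * (LINT x|leb. W x * deriv \<phi> x) + d * (LINT x|leb. W x * deriv \<eta> x)"
    if \<phi>: "\<phi> \<in> test_functions ivl" for \<phi> c d
  proof -
    have "(LINT x|leb. W x * deriv (\<lambda>x. c * \<phi> x + d * \<eta> x) x) =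
        (LINT x|leb. c * (W x * deriv \<phi> x) + d * (W x * deriv \<eta> x))"
      unfolding deriv_comb_test[OF \<phi> \<eta>(1)] by (simp add: algebra_simps)
    also have "\<dots> = c * (LINT x|leb. W x * deriv \<phi> x) + d * (LINT x|leb. W x * deriv \<eta> x)"
      using int[OF \<phi>] int[OF \<eta>(1)] by simp
    finally show ?thesis .
  qed
  have mean0: "(LINT x|leb. c * \<phi> x + d * \<eta> x) = c * (LINT x|leb. \<phi> x) + d"
    if \<phi>: "\<phi> \<in> test_functions ivl" for \<phi> c d
    using int(3)[OF \<phi>] int(3)[OF \<eta>(1)] \<eta>(4) by simp
  have nonneg: "0 \<le> (LINT x|leb. \<phi> x)" if "\<And>x. x \<in> ivl \<Longrightarrow> 0 \<le> \<phi> x" for \<phi> :: "real \<Rightarrow> real"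
    by (rule Bochner_Integration.integral_nonneg) (use that in auto)
  show ?thesis
  proof (intro exI[of _ l] conjI ballI allI impI)
    fix \<phi> :: "real \<Rightarrow> real" assume \<phi>: "\<phi> \<in> test_functions ivl" and "\<forall>x\<in>ivl. 0 \<le> \<phi> x"
    then have pos: "\<And>x. x \<in> ivl \<Longrightarrow> 0 \<le> \<phi> x" by blast
    define c where "c = (LINT x|leb. \<phi> x)"
    have c: "c \<ge> 0" unfolding c_def by (rule nonneg[OF pos])
    define V where "V x = (-1) * \<phi> x + c * \<eta> x" for x
    have "0 \<le> (LINT x|leb. W x * deriv V x)"
    proof (rule var)
      show "V \<in> test_functions ivl" unfolding V_def[abs_def] by (rule test_function_comb[OF \<phi> \<eta>(1)])
      show "(LINT x|leb. V x) = 0" unfolding V_def mean0[OF \<phi>] by (simp add: c_def)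
      show "s x0 / 2 \<le> s x" if "x \<in> ivl" "V x > 0" for x
      proof (rule \<eta>_pos[OF that(1)])
        have "\<eta> x \<noteq> 0" using that pos[OF that(1)] by (auto simp: V_def)
        then show "\<eta> x > 0" using \<eta>(2)[of x] by simp
      qed
    qed (use x0 in simp)
    then show "(LINT x|leb. (W x - l * x) * deriv \<phi> x) \<le> 0"
      unfolding V_def[abs_def] corrected[OF \<phi>] key[OF \<phi>] c_def by simp
  next
    fix \<phi> :: "real \<Rightarrow> real" and \<delta> :: real
    assume \<phi>: "\<phi> \<in> test_functions ivl" and \<delta>0: "0 < \<delta>"
      and "\<forall>x\<in>ivl. 0 \<le> \<phi> x \<and> (\<phi> x > 0 \<longrightarrow> \<delta> \<le> s x)"
    then have pos: "\<And>x. x \<in> ivl \<Longrightarrow> 0 \<le> \<phi> x" and \<delta>: "\<And>x. x \<in> ivl \<Longrightarrow> \<phi> x > 0 \<Longrightarrow> \<delta> \<le> s x"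
      by blast+
    define c where "c = (LINT x|leb. \<phi> x)"
    have c: "c \<ge> 0" unfolding c_def by (rule nonneg[OF pos])
    define V where "V x = 1 * \<phi> x + (- c) * \<eta> x" for x
    have "0 \<le> (LINT x|leb. W x * deriv V x)"
    proof (rule var[OF _ _ \<delta>0])
      show "V \<in> test_functions ivl" unfolding V_def[abs_def] by (rule test_function_comb[OF \<phi> \<eta>(1)])
      show "(LINT x|leb. V x) = 0" unfolding V_def mean0[OF \<phi>] by (simp add: c_def)
      show "\<delta> \<le> s x" if "x \<in> ivl" "V x > 0" for x
      proof (rule \<delta>[OF that(1)])
        have "c * \<eta> x \<ge> 0" using c \<eta>(2)[of x] by simp
        then show "\<phi> x > 0" using that(2) by (simp add: V_def)
      qed
    qed
    then show "0 \<le> (LINT x|leb. (W x - l * x) * deriv \<phi> x)"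
      unfolding V_def[abs_def] corrected[OF \<phi>] key[OF \<phi>] c_def by simp
  qed
qed

section \<open>The contact set\<close>

text \<open>
    A function whose slopes increase across a point where it touches a differentiable function from below is
    differentiable there, with the same derivative: the difference quotients on the two sides are squeezed between those of
    \<open>F\<close> and their common limit.
\<close>

lemma has_deriv_touching:
  fixes P F :: "real \<Rightarrow> real"
  assumes F: "(F has_real_derivative D) (at x0)" and lr: "l < x0" "x0 < r"
    and le: "\<And>x. l < x \<Longrightarrow> x < r \<Longrightarrow> P x - P x0 \<le> F x - F x0"
    and slopes: "\<And>x z. l < x \<Longrightarrow> x < x0 \<Longrightarrow> x0 < z \<Longrightarrow> z < r \<Longrightarrow>
      (P x0 - P x) / (x0 - x) \<le> (P z - P x0) / (z - x0)"
  shows "(P has_real_derivative D) (at x0)"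
proof -
  let ?p = "\<lambda>y. (P y - P x0) / (y - x0)" and ?q = "\<lambda>y. (F y - F x0) / (y - x0)"
  have q: "(?q \<longlongrightarrow> D) (at_left x0)" "(?q \<longlongrightarrow> D) (at_right x0)"
    using F by (auto simp: has_field_derivative_iff filterlim_at_split)
  have flip: "(P x0 - P x) / (x0 - x) = ?p x" for x
    by (metis minus_diff_eq minus_divide_divide)
  have left: "eventually (\<lambda>x. l < x \<and> x < x0) (at_left x0)"
    using lr(1) eventually_at_left_field by blast
  have right: "eventually (\<lambda>z. x0 < z \<and> z < r) (at_right x0)"
    using lr(2) eventually_at_right_field by blast
  have pq_left: "?q x \<le> ?p x" if "l < x" "x < x0" for x
    using le[of x] that lr by (auto intro!: divide_right_mono_neg)
  have pq_right: "?p z \<le> ?q z" if "x0 < z" "z < r" for z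
    using le[of z] that lr by (auto intro!: divide_right_mono)
  have pp: "?p x \<le> ?p z" if "l < x" "x < x0" "x0 < z" "z < r" for x z
    using slopes[OF that] unfolding flip .
  have D_le: "D \<le> ?p z" if "x0 < z" "z < r" for z
    by (rule tendsto_upperbound[OF q(1)])
      (use left in \<open>auto elim!: eventually_mono intro: order_trans[OF pq_left pp] that\<close>)
  have le_D: "?p x \<le> D" if "l < x" "x < x0" for x
    by (rule tendsto_lowerbound[OF q(2)])
      (use right in \<open>auto elim!: eventually_mono intro: order_trans[OF pp pq_right] that\<close>)
  have "(?p \<longlongrightarrow> D) (at_left x0)"
    by (rule tendsto_sandwich[OF _ _ q(1) tendsto_const])
      (use left in \<open>auto elim!: eventually_mono intro: pq_left le_D\<close>)
  moreover have "(?p \<longlongrightarrow> D) (at_right x0)"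
    by (rule tendsto_sandwich[OF _ _ tendsto_const q(2)])
      (use right in \<open>auto elim!: eventually_mono intro: pq_right D_le\<close>)
  ultimately show ?thesis by (simp add: has_field_derivative_iff filterlim_at_split)
qed

text \<open>
    An open set of reals has countably many components, so the integral over it is the sum of the
    integrals over the components.
\<close>

lemma set_integral_zero_on_components:
  fixes f :: "real \<Rightarrow> real"
  assumes U: "open U" and meas: "\<And>K. K \<in> components U \<Longrightarrow> K \<in> sets M"
    and int: "set_integrable M U f" and zero: "\<And>K. K \<in> components U \<Longrightarrow> (LINT x:K|M. f x) = 0"
  shows "(LINT x:U|M. f x) = 0"
proof -
  have count: "countable (components U)"
    by (rule countable_disjoint_open_subsets)
      (use U open_components pairwise_disjoint_components[of U] in \<open>auto simp: pairwise_def disjnt_def\<close>)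
  \<comment> \<open>Enumerate the components by natural numbers, filling up with empty sets if there are finitely many.\<close>
  define A where "A n = \<Union>{K \<in> components U. to_nat_on (components U) K = n}" for n
  have A: "A n = {} \<or> A n \<in> components U" for n
  proof (cases "\<exists>K\<in>components U. to_nat_on (components U) K = n")
    case True
    then obtain K where K: "K \<in> components U" "to_nat_on (components U) K = n" by blast
    then have "{K \<in> components U. to_nat_on (components U) K = n} = {K}"
      using inj_on_to_nat_on[OF count] by (auto simp: inj_on_def)
    then show ?thesis using K(1) by (simp add: A_def)
  qed (auto simp: A_def)
  have UA: "U = (\<Union>n. A n)"
  proof -
    have "(\<Union>n. A n) = \<Union>(components U)" unfolding A_def by blast
    then show ?thesis using Union_components[of U] by argo
  qed
  have zeroA: "(LINT x:(A n)|M. f x) = 0" for n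
    using A[of n] zero by (auto simp: set_lebesgue_integral_def)
  have "(LINT x:(\<Union>n. A n)|M. f x) = (\<Sum>n. (LINT x:(A n)|M. f x))"
  proof (rule lebesgue_integral_countable_add)
    show "A n \<in> sets M" for n using A[of n] meas by auto
    show "A i \<inter> A j = {}" if "i \<noteq> j" for i j
      using that pairwise_disjoint_components[of U]
      unfolding A_def pairwise_def disjnt_def by fastforce
    show "set_integrable M (\<Union>n. A n) f" using int UA by simp
  qed
  then show ?thesis using UA zeroA by simp
qed

lemma component_eq_interval:
  fixes U :: "real set"
  assumes K: "K \<in> components U" and r: "r \<in> K" and "p < r" "r < q" and sub: "{p<..<q} \<subseteq> U"
    and pq: "p \<notin> U" "q \<notin> U"
  shows "K = {p<..<q}"
proof
  have "{p<..<q} \<inter> K \<noteq> {}" using r \<open>p < r\<close> \<open>r < q\<close> by auto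
  then show "{p<..<q} \<subseteq> K"
    by (intro components_maximal[OF K] sub) auto
  have conn: "connected K" and KU: "K \<subseteq> U"
    using K in_components_connected in_components_subset by blast+
  show "K \<subseteq> {p<..<q}"
  proof
    fix x assume x: "x \<in> K"
    have "p \<in> K" if "x \<le> p"
      using connectedD_interval[OF conn x r that] \<open>p < r\<close> by simp
    moreover have "q \<in> K" if "q \<le> x"
      using connectedD_interval[OF conn r x] that \<open>r < q\<close> by simp
    ultimately show "x \<in> {p<..<q}" using KU pq by force
  qed
qed

lemma primitive_diff:
  assumes "integrable leb w" "-1 \<le> a" "a \<le> b" "b \<le> 1"
  shows "integral {a..b} w = integral {-1..b} w - integral {-1..a} (w :: real \<Rightarrow> real)"
proof -
  have "w integrable_on {-1..b}"
    by (rule integrable_on_subinterval(1)[OF assms(1) order_refl assms(4)])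
  from Henstock_Kurzweil_Integration.integral_combine[OF assms(2,3) this] show ?thesis by linarith
qed

text \<open>
    The situation reached after introducing the multiplier, with the constant \<open>\<beta>\<close> absorbed into the gap \<open>s\<close>.  The
    assumptions on \<open>W\<close> say that its averages increase, and that they are constant where \<open>s\<close> is positive.
\<close>

locale obstacle_contact =
  fixes W s m M :: "real \<Rightarrow> real" and m0 :: real
  assumes W_int: "integrable leb W" and m_int: "integrable leb m"
    and M_eq: "\<And>x. M x = m0 + integral {-1..x} m"
    and s_nonneg: "\<And>x. x \<in> ivl \<Longrightarrow> 0 \<le> s x"
    and s_diff: "\<And>x z. -1 < x \<Longrightarrow> x \<le> z \<Longrightarrow> z < 1 \<Longrightarrow> s z - s x = integral {x..z} M - integral {x..z} W"
    and slopes_le: "\<And>a b c. -1 < a \<Longrightarrow> a < b \<Longrightarrow> b < c \<Longrightarrow> c < 1 \<Longrightarrow>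
      integral {a..b} W / (b - a) \<le> integral {b..c} W / (c - b)"
    and slopes_ge: "\<And>a b c. -1 < a \<Longrightarrow> a < b \<Longrightarrow> b < c \<Longrightarrow> c < 1 \<Longrightarrow> (\<And>x. x \<in> {a..c} \<Longrightarrow> s x > 0) \<Longrightarrow>
      integral {b..c} W / (c - b) \<le> integral {a..b} W / (b - a)"
begin

text \<open>
    Since \<open>W\<close> is only given up to null sets, its continuous version is constructed as the derivative \<open>D\<close> of its
    primitive \<open>P\<close>.  The function \<open>g\<close> will turn out to be the derivative of \<open>D\<close>.
\<close>

definition P :: "real \<Rightarrow> real" where "P x = integral {-1..x} W"

definition D :: "real \<Rightarrow> real" where "D = deriv P"

definition g :: "real \<Rightarrow> real" where "g x = (if s x = 0 then m x else 0)"

lemma P_diff: "-1 \<le> a \<Longrightarrow> a \<le> b \<Longrightarrow> b \<le> 1 \<Longrightarrow> integral {a..b} W = P b - P a"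
  using primitive_diff[OF W_int, of a b] by (simp add: P_def)

lemma P_continuous_on: "continuous_on {-1..1} P"
  unfolding P_def[abs_def] by (rule continuous_on_primitive[OF W_int])

lemma M_continuous_on: "continuous_on {-1..1} M"
  unfolding M_eq[abs_def] by (intro continuous_intros continuous_on_primitive m_int)

lemma M_int: "integrable leb M"
  by (rule L2_integrable[OF continuous_L2[OF M_continuous_on]])

lemma M_diff: "-1 \<le> a \<Longrightarrow> a \<le> b \<Longrightarrow> b \<le> 1 \<Longrightarrow> integral {a..b} m = M b - M a"
  using primitive_diff[OF m_int, of a b] by (simp add: M_eq)

lemma M_primitive_has_deriv:
  assumes "x \<in> ivl" shows "((\<lambda>x. integral {-1..x} M) has_real_derivative M x) (at x)"
proof -
  have "((\<lambda>x. integral {-1..x} M) has_real_derivative M x) (at x within {-1..1})"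
    by (rule integral_has_real_derivative[OF M_continuous_on]) (use assms in auto)
  moreover have "x \<in> interior {-1..1}" using assms by simp
  ultimately show ?thesis by (simp only: at_within_interior)
qed

lemma s_continuous_on: "continuous_on ivl s"
proof -
  have "continuous_on ivl (\<lambda>x. s 0 + (integral {-1..x} M - integral {-1..0} M) - (P x - P 0))"
    by (intro continuous_intros continuous_on_subset[OF P_continuous_on]
        continuous_on_subset[OF continuous_on_primitive[OF M_int]]) auto
  moreover have "s 0 + (integral {-1..x} M - integral {-1..0} M) - (P x - P 0) = s x" if "x \<in> ivl" for x
  proof (cases "x \<ge> 0")
    case True
    then show ?thesis
      using s_diff[of 0 x] primitive_diff[OF M_int, of 0 x] P_diff[of 0 x] that by auto
  next
    case False
    then show ?thesis
      using s_diff[of x 0] primitive_diff[OF M_int, of x 0] P_diff[of x 0] that by auto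
  qed
  ultimately show ?thesis by (rule continuous_on_eq)
qed

text \<open>
    At a contact point \<open>s\<close> is minimal, which says that \<open>P\<close> touches the primitive of \<open>M\<close> from below.
\<close>

lemma contact_deriv:
  assumes x0: "x0 \<in> ivl" and contact: "s x0 = 0" shows "(P has_real_derivative M x0) (at x0)"
proof (rule has_deriv_touching[OF M_primitive_has_deriv[OF x0], of "-1" 1])
  show "-1 < x0" "x0 < 1" using x0 by auto
  show "P x - P x0 \<le> integral {-1..x} M - integral {-1..x0} M" if x: "-1 < x" "x < 1" for x
  proof (cases "x0 \<le> x")
    case True
    then show ?thesis
      using s_diff[of x0 x] s_nonneg[of x] primitive_diff[OF M_int, of x0 x] P_diff[of x0 x] x x0 contact by auto
  next
    case False
    then show ?thesis
      using s_diff[of x x0] s_nonneg[of x] primitive_diff[OF M_int, of x x0] P_diff[of x x0] x x0 contact by auto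
  qed
  show "(P x0 - P x) / (x0 - x) \<le> (P z - P x0) / (z - x0)" if "-1 < x" "x < x0" "x0 < z" "z < 1" for x z
    using slopes_le[OF that] P_diff[of x x0] P_diff[of x0 z] that by simp
qed

text \<open>
    Equality of the slopes on both sides of every intermediate point \<open>y\<close>.
\<close>

lemma affine_off_contact:
  assumes ab: "-1 < a" "a < b" "b < 1" and pos: "\<And>x. x \<in> {a..b} \<Longrightarrow> s x > 0" and y: "y \<in> {a..b}"
  shows "P y = P a + (P b - P a) / (b - a) * (y - a)"
proof (cases "y = a \<or> y = b")
  case False
  then have y': "a < y" "y < b" using y by auto
  have "(P y - P a) / (y - a) = (P b - P y) / (b - y)"
    using slopes_le[of a y b] slopes_ge[of a y b] ab y' pos P_diff[of a y] P_diff[of y b] by simp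
  then have "(P y - P a) * (b - y) = (P b - P y) * (y - a)" using y' by (simp add: field_simps)
  then have "(P y - P a) * (b - a) = (P b - P a) * (y - a)" by (simp add: algebra_simps)
  then have "P y - P a = (P b - P a) * (y - a) / (b - a)"
    using ab by (simp add: eq_divide_eq)
  then show ?thesis by simp
qed (use ab in auto)

lemma locally_constant_deriv_off_contact:
  assumes x: "x \<in> ivl" and pos: "s x > 0"
  obtains l r k where "l < x" "x < r" "\<And>y. y \<in> {l<..<r} \<Longrightarrow> (P has_real_derivative k) (at y)"
proof -
  have "open {y \<in> ivl. s y > 0}"
    using continuous_open_preimage[OF s_continuous_on open_greaterThanLessThan open_greaterThan[of 0]]
    by (simp add: vimage_def Int_def conj_commute)
  then obtain e where e: "e > 0" "cball x e \<subseteq> {y \<in> ivl. s y > 0}"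
    using x pos unfolding open_contains_cball by blast
  define a b where "a = x - e" and "b = x + e"
  have "{a..b} = cball x e" by (auto simp: a_def b_def dist_real_def)
  then have ab: "\<And>y. y \<in> {a..b} \<Longrightarrow> y \<in> ivl \<and> s y > 0" using e by blast
  have lt: "a < x" "x < b" using e by (auto simp: a_def b_def)
  then have ivl_ab: "-1 < a" "b < 1" using ab[of a] ab[of b] by auto
  define k where "k = (P b - P a) / (b - a)"
  show ?thesis
  proof (rule that[OF lt])
    fix y assume y: "y \<in> {a<..<b}"
    have "((\<lambda>y. P a + k * (y - a)) has_real_derivative k) (at y)"
      by (auto intro!: derivative_eq_intros)
    then show "(P has_real_derivative k) (at y)"
    proof (rule has_field_derivative_transform_within_open[of _ _ _ "{a<..<b}"])
      show "P a + k * (z - a) = P z" if "z \<in> {a<..<b}" for z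
        unfolding k_def by (rule affine_off_contact[symmetric]) (use that ivl_ab lt ab in auto)
    qed (use y in auto)
  qed
qed

lemma D_has_deriv: "x \<in> ivl \<Longrightarrow> (P has_real_derivative D x) (at x)"
proof -
  assume x: "x \<in> ivl"
  have "\<exists>k. (P has_real_derivative k) (at x)"
  proof (cases "s x = 0")
    case True
    then show ?thesis using contact_deriv[OF x] by blast
  next
    case False
    then have "s x > 0" using s_nonneg[OF x] by simp
    from locally_constant_deriv_off_contact[OF x this] obtain l r k where
      "l < x" "x < r" "\<And>y. y \<in> {l<..<r} \<Longrightarrow> (P has_real_derivative k) (at y)" by metis
    then have "(P has_real_derivative k) (at x)" by simp
    then show ?thesis by blast
  qed
  then show "(P has_real_derivative D x) (at x)"
    unfolding D_def using DERIV_imp_deriv by blast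
qed

lemma D_contact: "x \<in> ivl \<Longrightarrow> s x = 0 \<Longrightarrow> D x = M x"
  unfolding D_def by (intro DERIV_imp_deriv contact_deriv)

text \<open>
    In the interior of a gap \<open>D\<close> is locally constant.  At the end points, \<open>P\<close> is differentiable and affine on one
    side, so that the value of \<open>D\<close> there is the slope of the affine piece, too.
\<close>

lemma D_gap:
  assumes ab: "-1 < a" "a < b" "b < 1" and pos: "\<And>x. a < x \<Longrightarrow> x < b \<Longrightarrow> s x > 0"
  shows "D a = D b"
proof -
  have "(D has_real_derivative 0) (at x)" if x: "x \<in> {a<..<b}" for x
  proof -
    have xi: "x \<in> ivl" using x ab by auto
    obtain l r k where lr: "l < x" "x < r" "\<And>y. y \<in> {l<..<r} \<Longrightarrow> (P has_real_derivative k) (at y)"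
      using locally_constant_deriv_off_contact[OF xi] pos x by (metis greaterThanLessThan_iff)
    show ?thesis
      by (rule has_field_derivative_transform_within_open[of "\<lambda>x. k" _ _ "{l<..<r}"])
        (use lr DERIV_imp_deriv[OF lr(3), symmetric] in \<open>auto simp: D_def\<close>)
  qed
  then have "\<exists>k. \<forall>x\<in>{a<..<b}. D x = k"
    by (intro has_field_derivative_zero_constant) (auto intro: has_field_derivative_at_within)
  then obtain k where k: "\<And>x. x \<in> {a<..<b} \<Longrightarrow> D x = k" by blast
  have lin: "P x - k * x = P a - k * a" if x: "x \<in> {a..b}" for x
  proof (rule DERIV_isconst2[of a b "\<lambda>x. P x - k * x"])
    show "continuous_on {a..b} (\<lambda>x. P x - k * x)"
      by (intro continuous_intros continuous_on_subset[OF P_continuous_on]) (use ab in auto)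
    show "((\<lambda>x. P x - k * x) has_real_derivative 0) (at y)" if "a < y" "y < b" for y
      using D_has_deriv[of y] k[of y] that ab by (auto intro!: derivative_eq_intros)
  qed (use ab x in auto)
  have ends: "D y = k" if y: "y \<in> {a..b}" for y
  proof -
    have "(P has_vector_derivative D y) (at y within {a..b})"
      using D_has_deriv[of y] y ab
      by (auto simp: has_real_derivative_iff_has_vector_derivative[symmetric] intro: has_field_derivative_at_within)
    moreover have "((\<lambda>x. k * x + (P a - k * a)) has_vector_derivative k) (at y within {a..b})"
      by (auto simp: has_real_derivative_iff_has_vector_derivative[symmetric] intro!: derivative_eq_intros)
    then have "(P has_vector_derivative k) (at y within {a..b})"
      by (rule has_vector_derivative_transform[rotated 2]) (use y lin in \<open>auto simp: algebra_simps\<close>)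
    ultimately show ?thesis
      using vector_derivative_unique_within_closed_interval[of a b y P] ab y by (auto simp: box_real)
  qed
  then show ?thesis using ab by simp
qed

lemma s_measurable: "s \<in> borel_measurable leb"
  by (rule continuous_imp_measurable_on_sets_lebesgue[OF s_continuous_on]) (use sets_ivl in simp)

lemma g_measurable: "g \<in> borel_measurable leb"
proof -
  have [measurable]: "s \<in> borel_measurable leb" "m \<in> borel_measurable leb"
    using s_measurable m_int by auto
  show ?thesis unfolding g_def[abs_def] by measurable
qed

lemma g_int: "integrable leb g"
  by (rule Bochner_Integration.integrable_bound[OF m_int g_measurable]) (auto simp: g_def)

lemma contact_closed:
  assumes "-1 < a" "b < 1" shows "closed {x \<in> {a..b}. s x = 0}"
proof -
  have "continuous_on {a..b} s" by (rule continuous_on_subset[OF s_continuous_on]) (use assms in auto)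
  from continuous_closed_preimage[OF this closed_atLeastAtMost, of "{0}"] show ?thesis
    by (simp add: vimage_def Int_def conj_commute)
qed

text \<open>
    The next two lemmas cut an interval at its last and at its first contact point; outside them no
    contact occurs.
\<close>

lemma last_contact:
  assumes "-1 < a" "b < 1" and "z \<in> {a..b}" "s z = 0"
  obtains q where "q \<in> {a..b}" "s q = 0" "z \<le> q" "\<And>x. q < x \<Longrightarrow> x \<le> b \<Longrightarrow> x \<in> {a..b} \<and> s x > 0"
proof -
  let ?C = "{x \<in> {a..b}. s x = 0}"
  have ne: "?C \<noteq> {}" and bdd: "bdd_above ?C" using assms by auto
  have q: "Sup ?C \<in> ?C" by (rule closed_contains_Sup[OF ne bdd contact_closed]) (use assms in auto)
  show ?thesis
  proof (rule that[of "Sup ?C"])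
    show "z \<le> Sup ?C" by (rule cSup_upper[OF _ bdd]) (use assms in auto)
    show "x \<in> {a..b} \<and> s x > 0" if x: "Sup ?C < x" "x \<le> b" for x
    proof -
      have xi: "x \<in> {a..b}" using x q by auto
      have "s x \<noteq> 0" using cSup_upper[OF _ bdd, of x] xi x by auto
      then show ?thesis using s_nonneg[of x] xi assms by auto
    qed
  qed (use q in auto)
qed

lemma first_contact:
  assumes "-1 < a" "b < 1" and "z \<in> {a..b}" "s z = 0"
  obtains p where "p \<in> {a..b}" "s p = 0" "p \<le> z" "\<And>x. a \<le> x \<Longrightarrow> x < p \<Longrightarrow> x \<in> {a..b} \<and> s x > 0"
proof -
  let ?C = "{x \<in> {a..b}. s x = 0}"
  have ne: "?C \<noteq> {}" and bdd: "bdd_below ?C" using assms by auto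
  have p: "Inf ?C \<in> ?C" by (rule closed_contains_Inf[OF ne bdd contact_closed]) (use assms in auto)
  show ?thesis
  proof (rule that[of "Inf ?C"])
    show "Inf ?C \<le> z" by (rule cInf_lower[OF _ bdd]) (use assms in auto)
    show "x \<in> {a..b} \<and> s x > 0" if x: "a \<le> x" "x < Inf ?C" for x
    proof -
      have xi: "x \<in> {a..b}" using x p by auto
      have "s x \<noteq> 0" using cInf_lower[OF _ bdd, of x] xi x by auto
      then show ?thesis using s_nonneg[of x] xi assms by auto
    qed
  qed (use p in auto)
qed

text \<open>
    The difference of \<open>m\<close> and \<open>g\<close> lives on the gaps.  Over a gap with end points \<open>p\<close> and \<open>q\<close>, the integral of \<open>m\<close>
    is \<open>M q - M p = D q - D p = 0\<close>.
\<close>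

lemma integral_g_between_contacts:
  assumes cd: "-1 < c" "c \<le> d" "d < 1" and contact: "s c = 0" "s d = 0"
  shows "integral {c..d} g = M d - M c"
proof -
  define U where "U = {x \<in> {c<..<d}. s x \<noteq> 0}"
  have U: "open U"
  proof -
    have "continuous_on {c<..<d} s" by (rule continuous_on_subset[OF s_continuous_on]) (use cd in auto)
    moreover have "open (- {0 :: real})" by auto
    ultimately have "open ({c<..<d} \<inter> s -` (- {0}))"
      using continuous_open_preimage open_greaterThanLessThan by blast
    moreover have "U = {c<..<d} \<inter> s -` (- {0})" by (auto simp: U_def)
    ultimately show ?thesis by simp
  qed
  have Kint: "(LINT x:K|leb. m x) = 0 \<and> K \<in> sets leb" if K: "K \<in> components U" for K
  proof -
    obtain r where r: "r \<in> K" using in_components_nonempty[OF K] by blast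
    then have rU: "c < r" "r < d" "s r \<noteq> 0" using in_components_subset[OF K] by (auto simp: U_def)
    obtain p where p: "p \<in> {c..r}" "s p = 0" "\<And>x. p < x \<Longrightarrow> x \<le> r \<Longrightarrow> x \<in> {c..r} \<and> s x > 0"
      by (rule last_contact[of c r c]) (use cd rU contact in auto)
    obtain q where q: "q \<in> {r..d}" "s q = 0" "\<And>x. r \<le> x \<Longrightarrow> x < q \<Longrightarrow> x \<in> {r..d} \<and> s x > 0"
      by (rule first_contact[of r d d]) (use cd rU contact in auto)
    have pq: "p < r" "r < q" using p q rU by (metis atLeastAtMost_iff order_le_less)+
    have pos: "s x > 0" if "p < x" "x < q" for x using p(3)[of x] q(3)[of x] that by linarith
    have Keq: "K = {p<..<q}"
    proof (rule component_eq_interval[OF K r pq])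
      show "{p<..<q} \<subseteq> U" using pos p(1) q(1) by (force simp: U_def)
    qed (use p q in \<open>auto simp: U_def\<close>)
    have bd: "-1 < p" "q < 1" using p q cd by auto
    have "D p = D q" by (rule D_gap) (use bd pq pos in auto)
    then have "M q - M p = 0" using D_contact[of p] D_contact[of q] bd pq p q by auto
    then have "integral {p..q} m = 0" using M_diff[of p q] bd pq by simp
    then have "(LINT x:K|leb. m x) = 0"
      using integrable_on_subinterval(2)[OF m_int, of p q] bd by (simp add: Keq set_lebesgue_integral_def)
    moreover have "K \<in> sets leb"
    proof -
      have "{p<..<q} \<in> sets lebesgue" by simp
      then show ?thesis unfolding Keq using bd pq sets_ivl by (subst sets_restrict_space_iff) auto
    qed
    ultimately show ?thesis by simp
  qed
  have "(LINT x:U|leb. m x) = 0"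
  proof (rule set_integral_zero_on_components[OF U])
    have "U \<in> sets leb"
    proof -
      have "U \<in> sets lebesgue" using U by simp
      moreover have "U \<subseteq> ivl" using cd by (auto simp: U_def)
      ultimately show ?thesis using sets_ivl by (subst sets_restrict_space_iff) auto
    qed
    then show "set_integrable leb U m"
      unfolding set_integrable_def using m_int by (rule integrable_mult_indicator)
  qed (use Kint in auto)
  also have "(LINT x:U|leb. m x) = (LINT x|leb. indicator {c<..<d} x * (m x - g x))"
    unfolding set_lebesgue_integral_def
    by (intro Bochner_Integration.integral_cong) (auto simp: U_def g_def indicator_def)
  also have "\<dots> = integral {c..d} (\<lambda>x. m x - g x)"
    by (rule integrable_on_subinterval(2)) (use m_int g_int cd in auto)
  also have "\<dots> = integral {c..d} m - integral {c..d} g"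
    by (intro Henstock_Kurzweil_Integration.integral_diff integrable_on_subinterval(1) m_int g_int) (use cd in auto)
  finally show ?thesis using M_diff[of c d] cd by simp
qed

lemma integral_g_gap:
  assumes "a \<le> b" and pos: "\<And>x. a < x \<Longrightarrow> x < b \<Longrightarrow> s x > 0"
  shows "integral {a..b} g = 0"
proof -
  have "integral {a<..<b} g = integral {a<..<b} (\<lambda>x. 0)"
    by (intro Henstock_Kurzweil_Integration.integral_cong) (use pos in \<open>force simp: g_def\<close>)
  then show ?thesis by (simp add: integral_open_interval_real)
qed

text \<open>
    Up to the first and from the last contact point, both \<open>D\<close> is constant and \<open>g\<close> vanishes; in between,
    \<open>D\<close> agrees with \<open>M\<close> at the two extreme contact points.
\<close>

lemma D_diff:
  assumes ab: "-1 < a" "a \<le> b" "b < 1" shows "D b - D a = integral {a..b} g"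
proof (cases "\<exists>z\<in>{a..b}. s z = 0")
  case False
  then have "s x > 0" if "x \<in> {a..b}" for x using s_nonneg[of x] that ab by force
  then show ?thesis
    using integral_g_gap[of a b] D_gap[of a b] ab by (cases "a = b") auto
next
  case True
  then obtain z where z: "z \<in> {a..b}" "s z = 0" by blast
  obtain d where d: "d \<in> {a..b}" "s d = 0" "z \<le> d" "\<And>x. d < x \<Longrightarrow> x \<le> b \<Longrightarrow> x \<in> {a..b} \<and> s x > 0"
    by (rule last_contact[OF ab(1,3) z]) blast
  obtain c where c: "c \<in> {a..b}" "s c = 0" "c \<le> z" "\<And>x. a \<le> x \<Longrightarrow> x < c \<Longrightarrow> x \<in> {a..b} \<and> s x > 0"
    by (rule first_contact[OF ab(1,3) z]) blast
  have gi: "g integrable_on {x..y}" if "a \<le> x" "y \<le> b" for x y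
    by (rule integrable_on_subinterval(1)[OF g_int]) (use that ab in auto)
  have "integral {a..b} g = integral {a..c} g + integral {c..b} g"
    by (rule Henstock_Kurzweil_Integration.integral_combine[symmetric]) (use c gi in auto)
  also have "integral {c..b} g = integral {c..d} g + integral {d..b} g"
    by (rule Henstock_Kurzweil_Integration.integral_combine[symmetric]) (use c d gi in auto)
  also have "integral {a..c} g = 0" by (rule integral_g_gap) (use c in auto)
  also have "integral {d..b} g = 0" by (rule integral_g_gap) (use d in auto)
  also have "integral {c..d} g = D d - D c"
    using integral_g_between_contacts[of c d] D_contact[of c] D_contact[of d] c d ab by auto
  also have "D c = D a" using D_gap[of a c] c ab by (cases "a = c") auto
  also have "D d = D b" using D_gap[of d b] d ab by (cases "d = b") auto
  finally show ?thesis by simp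
qed

text \<open>
    \<open>D\<close> is continuous, being a primitive, so that the integral of \<open>D\<close> over an interval is the increment of \<open>P\<close>,
    which is the integral of \<open>W\<close>.
\<close>

theorem W_absolutely_continuous: "\<exists>c. AE x in leb. W x = c + integral {-1..x} g"
proof -
  define c where "c = D 0 - integral {-1..0} g"
  have D_eq: "D x = c + integral {-1..x} g" if "x \<in> ivl" for x
  proof (cases "x \<ge> 0")
    case True
    then show ?thesis
      using D_diff[of 0 x] primitive_diff[OF g_int, of 0 x] that by (auto simp: c_def)
  next
    case False
    then show ?thesis
      using D_diff[of x 0] primitive_diff[OF g_int, of x 0] that by (auto simp: c_def)
  qed
  have R: "(\<lambda>x. c + integral {-1..x} g) \<in> L2_space ivl"
    by (intro continuous_L2 continuous_intros continuous_on_primitive g_int)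
  have "AE x in leb. W x - (c + integral {-1..x} g) = 0"
  proof (rule AE_zero_if_interval_integrals_zero)
    show "integrable leb (\<lambda>x. W x - (c + integral {-1..x} g))"
      by (intro Bochner_Integration.integrable_diff W_int L2_integrable R)
    fix a b :: real assume ab: "-1 < a" "a < b" "b < 1"
    have D_integral: "((\<lambda>x. c + integral {-1..x} g) has_integral (P b - P a)) {a..b}"
    proof (rule fundamental_theorem_of_calculus)
      fix x assume x: "x \<in> {a..b}"
      then have "(P has_real_derivative c + integral {-1..x} g) (at x)"
        using D_has_deriv[of x] D_eq[of x] ab by auto
      then show "(P has_vector_derivative c + integral {-1..x} g) (at x within {a..b})"
        by (auto simp: has_real_derivative_iff_has_vector_derivative[symmetric] intro: has_field_derivative_at_within)
    qed (use ab in auto)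
    have "(W has_integral (P b - P a)) {a..b}"
      using P_diff[of a b] integrable_on_subinterval(1)[OF W_int, of a b] ab by (simp add: has_integral_iff)
    from has_integral_diff[OF this D_integral]
    have "((\<lambda>x. W x - (c + integral {-1..x} g)) has_integral 0) {a..b}" by simp
    then show "integral {a..b} (\<lambda>x. W x - (c + integral {-1..x} g)) = 0" by (rule integral_unique)
  qed
  then show ?thesis by (intro exI[of _ c]) (auto elim: eventually_mono)
qed

end

section \<open>Regularity of the minimizer\<close>

lemma AE_nonneg_continuous:
  fixes s :: "real \<Rightarrow> real"
  assumes s: "continuous_on ivl s" and ae: "AE x in leb. 0 \<le> s x" and x: "x \<in> ivl"
  shows "0 \<le> s x"
proof (rule ccontr)
  assume neg: "\<not> 0 \<le> s x"
  let ?N = "{y \<in> ivl. s y < 0}"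
  have "open ?N"
    using continuous_open_preimage[OF s open_greaterThanLessThan open_lessThan[of 0]]
    by (simp add: vimage_def Int_def conj_commute)
  moreover have "?N \<noteq> {}" using neg x by auto
  ultimately have "\<not> negligible ?N" by (rule open_not_negligible)
  moreover have "AE y in lebesgue. y \<in> ivl \<longrightarrow> 0 \<le> s y"
    using ae AE_restrict_space_iff[OF sets_ivl, of "\<lambda>y. 0 \<le> s y"] by simp
  then obtain N where N: "N \<in> null_sets lebesgue" "{y. \<not> (y \<in> ivl \<longrightarrow> 0 \<le> s y)} \<subseteq> N"
    by (auto simp: eventually_ae_filter)
  then have "?N \<subseteq> N" by force
  then have "negligible ?N" using N(1) negligible_iff_null_sets negligible_subset by blast
  ultimately show False by simp
qed

lemma integral_cong_AE_ivl:
  assumes "integrable leb v" "integrable leb w" "AE x in leb. v x = (w x :: real)" "-1 \<le> a" "b \<le> 1"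
  shows "integral {a..b} v = integral {a..b} w"
proof -
  have "(LINT x|leb. indicator {a<..<b} x * v x) = (LINT x|leb. indicator {a<..<b} x * w x)"
  proof (rule integral_cong_AE)
    have ind: "indicat_real {a<..<b} \<in> borel_measurable leb" by (rule measurable_leb) simp
    show "(\<lambda>x. indicator {a<..<b} x * v x) \<in> borel_measurable leb"
      by (intro borel_measurable_times ind borel_measurable_integrable assms)
    show "(\<lambda>x. indicator {a<..<b} x * w x) \<in> borel_measurable leb"
      by (intro borel_measurable_times ind borel_measurable_integrable assms)
    show "AE x in leb. indicator {a<..<b} x * v x = indicator {a<..<b} x * w x"
      using assms(3) by eventually_elim simp
  qed
  then show ?thesis using integrable_on_subinterval(2) assms by metis
qed

lemma has_weak_deriv_primitive_self:
  assumes "g \<in> L2_space ivl" shows "has_weak_deriv 1 ivl (\<lambda>x. integral {-1..x} g) g"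
  by (rule has_weak_deriv_primitive[OF assms, of _ 0])
    (auto intro: continuous_on_measurable_leb continuous_on_primitive L2_integrable assms)

lemma Sobolev_3I:
  assumes "has_weak_deriv 1 ivl y p" "has_weak_deriv 1 ivl p q" "has_weak_deriv 1 ivl q r"
  shows "y \<in> Sobolev_space 3 ivl"
proof -
  have "has_weak_deriv 0 ivl y y" using has_weak_deriv_0[OF has_weak_deriv_L2(1)[OF assms(1)]] .
  moreover have 2: "has_weak_deriv 2 ivl y q"
    using has_weak_deriv_Suc[OF assms(1,2)] by (simp add: numeral_2_eq_2)
  moreover have "has_weak_deriv 3 ivl y r"
    using has_weak_deriv_Suc[OF 2 assms(3)] by (simp add: numeral_3_eq_3 numeral_2_eq_2)
  ultimately show ?thesis using assms(1)
    by (auto simp: Sobolev_space_def le_Suc_eq numeral_3_eq_3 numeral_2_eq_2)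
qed

text \<open>
    The continuous version of the gap \<open>\<psi> - y'\<close>.  If it vanished identically, \<open>\<psi>\<close> and \<open>y'\<close> would have the
    same integral.
\<close>

lemma gap_of_minimizer:
  assumes \<psi>: "has_weak_deriv 1 ivl \<psi> \<psi>1" and p: "has_weak_deriv 1 ivl p q"
    and le: "AE x in leb. p x \<le> \<psi> x" and mean: "(LINT x|leb. p x) < (LINT x|leb. \<psi> x)"
  obtains s where "continuous_on {-1..1} s" "AE x in leb. \<psi> x - p x = s x"
    "\<And>x. x \<in> ivl \<Longrightarrow> 0 \<le> s x" "\<exists>x\<in>ivl. s x > 0"
    "\<And>x z. -1 < x \<Longrightarrow> x \<le> z \<Longrightarrow> z < 1 \<Longrightarrow> s z - s x = integral {x..z} (\<lambda>t. \<psi>1 t - q t)"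
proof -
  have d: "has_weak_deriv 1 ivl (\<lambda>x. \<psi> x - p x) (\<lambda>x. \<psi>1 x - q x)"
    using has_weak_deriv_comb[OF \<psi> p, of 1 "-1"] by simp
  have int: "integrable leb (\<lambda>x. \<psi>1 x - q x)" by (rule L2_integrable[OF has_weak_deriv_L2(2)[OF d]])
  obtain c where c: "AE x in leb. \<psi> x - p x = c + integral {-1..x} (\<lambda>x. \<psi>1 x - q x)"
    by (rule weak_deriv_primitive_rep[OF d])
  define s where "s x = c + integral {-1..x} (\<lambda>x. \<psi>1 x - q x)" for x
  have cont: "continuous_on {-1..1} s"
    unfolding s_def[abs_def] by (intro continuous_intros continuous_on_primitive int)
  have ae: "AE x in leb. \<psi> x - p x = s x" using c by (simp add: s_def)
  have nonneg: "0 \<le> s x" if "x \<in> ivl" for x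
  proof (rule AE_nonneg_continuous[OF _ _ that])
    show "continuous_on ivl s" by (rule continuous_on_subset[OF cont]) auto
    show "AE x in leb. 0 \<le> s x" using ae le by eventually_elim simp
  qed
  have "\<exists>x\<in>ivl. s x > 0"
  proof (rule ccontr)
    assume "\<not> (\<exists>x\<in>ivl. s x > 0)"
    then have "s x = 0" if "x \<in> space leb" for x using nonneg[of x] that by force
    then have "AE x in leb. s x = 0" by (rule AE_I2)
    with ae have "AE x in leb. \<psi> x = p x" by eventually_elim simp
    then have "(LINT x|leb. \<psi> x) = (LINT x|leb. p x)"
      by (intro integral_cong_AE L2_measurable has_weak_deriv_L2(1)[OF \<psi>] has_weak_deriv_L2(1)[OF p])
    with mean show False by simp
  qed
  moreover have "s z - s x = integral {x..z} (\<lambda>t. \<psi>1 t - q t)" if "-1 < x" "x \<le> z" "z < 1" for x z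
    using primitive_diff[OF int, of x z] that by (simp add: s_def)
  ultimately show ?thesis using that[OF cont ae nonneg] by blast
qed

text \<open>
    A direction \<open>V\<close> that is positive only where the gap is at least \<open>\<delta>\<close> is feasible for small steps, because
    \<open>V\<close> is bounded.  The perturbation \<open>\<Phi>\<close> is the primitive of \<open>V\<close>, and two integrations by
    parts replace \<open>y - y\<^sub>d\<close> by its second primitive, tested with \<open>\<Phi>'' = V'\<close>.
\<close>

lemma variational_inequality:
  assumes opt: "is_arg_min (cost ivl \<beta> y_d) (\<lambda>p. p \<in> admissible ivl f \<psi>) (y, u)" and \<beta>: "\<beta> > 0"
    and f: "f \<in> L2_space ivl" and yd: "y_d \<in> L2_space ivl"
    and ae: "AE x in leb. \<psi> x - weak_deriv ivl y x = s x" and nonneg: "\<And>x. x \<in> ivl \<Longrightarrow> 0 \<le> s x"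
    and V: "V \<in> test_functions ivl" "(LINT x|leb. V x) = 0"
    and \<delta>: "\<delta> > 0" "\<And>x. x \<in> ivl \<Longrightarrow> V x > 0 \<Longrightarrow> \<delta> \<le> s x"
  shows "0 \<le> (LINT x|leb. (integral {-1..x} (\<lambda>x. integral {-1..x} (\<lambda>x. y x - y_d x)) - \<beta> * u x) * deriv V x)"
proof -
  have adm: "(y, u) \<in> admissible ivl f \<psi>" using opt by (simp add: is_arg_min_def)
  then have y: "y \<in> H10_space ivl" and u: "u \<in> L2_space ivl" by (auto simp: admissible_def)
  define h where "h x = y x - y_d x" for x
  define H where "H x = integral {-1..x} h" for x
  define H0 where "H0 x = integral {-1..x} H" for x
  have h: "h \<in> L2_space ivl"
    unfolding h_def[abs_def] by (rule L2_diff[OF has_weak_deriv_L2(1)[OF H10_has_weak_deriv[OF y]] yd])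
  have dH: "has_weak_deriv 1 ivl H h"
    unfolding H_def[abs_def] by (rule has_weak_deriv_primitive_self[OF h])
  have dH0: "has_weak_deriv 1 ivl H0 H"
    unfolding H0_def[abs_def] by (rule has_weak_deriv_primitive_self[OF has_weak_deriv_L2(1)[OF dH]])
  define \<Phi> where "\<Phi> x = integral {-1..x} V" for x
  have \<Phi>: "\<Phi> \<in> test_functions ivl" unfolding \<Phi>_def[abs_def] by (rule test_function_primitive(1)[OF V])
  have d\<Phi>: "deriv \<Phi> = V"
    unfolding \<Phi>_def[abs_def] by (rule ext, rule DERIV_imp_deriv, rule test_function_primitive(2)[OF V])
  have dV: "deriv V \<in> L2_space ivl" by (rule test_function_L2[OF test_function_deriv[OF V(1)]])
  obtain B where B: "B \<ge> 0" "\<And>x. x \<in> {-1..1} \<Longrightarrow> \<bar>V x\<bar> \<le> B"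
    by (rule continuous_on_bounded_ivl[OF test_function_continuous_on[OF V(1)]]) blast
  define \<epsilon> where "\<epsilon> = \<delta> / (B + 1)"
  have \<epsilon>: "\<epsilon> > 0" using \<delta>(1) B(1) by (simp add: \<epsilon>_def)
  have small: "\<epsilon> * V x \<le> s x" if x: "x \<in> ivl" for x
  proof (cases "V x > 0")
    case True
    have "\<epsilon> * V x \<le> \<epsilon> * (B + 1)" using B(2)[of x] x \<epsilon> by (intro mult_left_mono) auto
    also have "\<dots> = \<delta>" using B(1) by (simp add: \<epsilon>_def)
    also have "\<dots> \<le> s x" by (rule \<delta>(2)[OF x True])
    finally show ?thesis .
  next
    case False
    then have "\<epsilon> * V x \<le> 0" using \<epsilon> by (simp add: mult_nonneg_nonpos)
    then show ?thesis using nonneg[OF x] by simp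
  qed
  have "AE x in leb. weak_deriv ivl y x + \<epsilon> * deriv \<Phi> x \<le> \<psi> x"
    using ae AE_space
  proof eventually_elim
    case (elim x)
    then show ?case using small[of x] by (simp add: d\<Phi>)
  qed
  from optimality_condition[OF opt f yd \<Phi> \<epsilon> this]
  have "0 \<le> (LINT x|leb. h x * \<Phi> x) - \<beta> * (LINT x|leb. u x * deriv V x)"
    by (simp add: h_def d\<Phi>)
  also have "(LINT x|leb. h x * \<Phi> x) = - (LINT x|leb. H x * V x)"
    using dH \<Phi> unfolding has_weak_deriv_1 d\<Phi>[symmetric] by simp
  also have "\<dots> = (LINT x|leb. H0 x * deriv V x)"
    using dH0 V(1) unfolding has_weak_deriv_1 by simp
  also have "\<dots> - \<beta> * (LINT x|leb. u x * deriv V x) = (LINT x|leb. H0 x * deriv V x - \<beta> * (u x * deriv V x))"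
    using L2_mult_integrable[OF has_weak_deriv_L2(1)[OF dH0] dV] L2_mult_integrable[OF u dV] by simp
  also have "\<dots> = (LINT x|leb. (H0 x - \<beta> * u x) * deriv V x)" by (simp add: algebra_simps)
  finally show ?thesis by (simp add: H0_def[abs_def] H_def[abs_def] h_def[abs_def])
qed

text \<open>
    Here the inequalities tested with \<open>\<phi>'\<close> are converted into statements about averages, so that the
    analysis of the contact set applies.
\<close>

lemma obstacle_multiplier_regularity:
  fixes W R s m :: "real \<Rightarrow> real"
  assumes W: "W \<in> L2_space ivl" and dR: "has_weak_deriv 1 ivl R m"
    and s_cont: "continuous_on ivl s" and s_nonneg: "\<And>x. x \<in> ivl \<Longrightarrow> 0 \<le> s x"
    and s_diff: "\<And>x z. -1 < x \<Longrightarrow> x \<le> z \<Longrightarrow> z < 1 \<Longrightarrow> s z - s x = integral {x..z} (\<lambda>t. R t - W t)"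
    and le: "\<And>\<phi>. \<phi> \<in> test_functions ivl \<Longrightarrow> (\<And>x. x \<in> ivl \<Longrightarrow> 0 \<le> \<phi> x) \<Longrightarrow>
      (LINT x|leb. W x * deriv \<phi> x) \<le> 0"
    and ge: "\<And>\<phi> \<delta>. \<phi> \<in> test_functions ivl \<Longrightarrow> \<delta> > 0 \<Longrightarrow>
      (\<And>x. x \<in> ivl \<Longrightarrow> 0 \<le> \<phi> x \<and> (\<phi> x > 0 \<longrightarrow> \<delta> \<le> s x)) \<Longrightarrow> 0 \<le> (LINT x|leb. W x * deriv \<phi> x)"
  shows "\<exists>g. has_weak_deriv 1 ivl W g"
proof -
  have m: "m \<in> L2_space ivl" and R: "R \<in> L2_space ivl" using has_weak_deriv_L2[OF dR] by auto
  obtain m0 where m0: "AE x in leb. R x = m0 + integral {-1..x} m"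
    by (rule weak_deriv_primitive_rep[OF dR])
  define M where "M x = m0 + integral {-1..x} m" for x
  have M: "M \<in> L2_space ivl"
    unfolding M_def[abs_def] by (intro continuous_L2 continuous_intros continuous_on_primitive L2_integrable m)
  note ints = L2_integrable[OF W] L2_integrable[OF M] L2_integrable[OF R]
  interpret obstacle_contact W s m M m0
  proof
    show "integrable leb W" "integrable leb m" using L2_integrable W m by auto
    show "M x = m0 + integral {-1..x} m" for x by (rule M_def)
    show "0 \<le> s x" if "x \<in> ivl" for x by (rule s_nonneg[OF that])
    show "s z - s x = integral {x..z} M - integral {x..z} W" if xz: "-1 < x" "x \<le> z" "z < 1" for x z
    proof -
      have "s z - s x = integral {x..z} (\<lambda>t. M t - W t)"
        unfolding s_diff[OF xz]
      proof (rule integral_cong_AE_ivl)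
        show "AE t in leb. R t - W t = M t - W t"
          using m0 by eventually_elim (simp add: M_def)
      qed (use xz ints in auto)
      also have "\<dots> = integral {x..z} M - integral {x..z} W"
        by (rule Henstock_Kurzweil_Integration.integral_diff; rule integrable_on_subinterval(1))
          (use ints xz in auto)
      finally show ?thesis .
    qed
    show "integral {a..b} W / (b - a) \<le> integral {b..c} W / (c - b)" if "-1 < a" "a < b" "b < c" "c < 1" for a b c
      by (rule averages_mono[OF ints(1) that(1,2) order_refl that(3,4)]) (rule le)
    show "integral {b..c} W / (c - b) \<le> integral {a..b} W / (b - a)"
      if abc: "-1 < a" "a < b" "b < c" "c < 1" and pos: "\<And>x. x \<in> {a..c} \<Longrightarrow> s x > 0" for a b c
    proof (rule averages_antimono[OF ints(1) abc(1,2) order_refl abc(3,4)])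
      have "continuous_on {a..c} s" by (rule continuous_on_subset[OF s_cont]) (use abc in auto)
      then obtain t where t: "t \<in> {a..c}" "\<And>x. x \<in> {a..c} \<Longrightarrow> s t \<le> s x"
        using continuous_attains_inf[of "{a..c}" s] abc by auto
      fix \<phi> :: "real \<Rightarrow> real" assume \<phi>: "\<phi> \<in> test_functions ivl" "\<And>x. x \<in> ivl \<Longrightarrow> 0 \<le> \<phi> x"
        and out: "\<And>x. x \<in> ivl \<Longrightarrow> x \<notin> {a..c} \<Longrightarrow> \<phi> x = 0"
      show "0 \<le> (LINT x|leb. W x * deriv \<phi> x)"
      proof (rule ge[OF \<phi>(1) pos[OF t(1)]])
        show "0 \<le> \<phi> x \<and> (\<phi> x > 0 \<longrightarrow> s t \<le> s x)" if "x \<in> ivl" for x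
          using out[OF that] t(2)[of x] \<phi>(2)[OF that] by fastforce
      qed
    qed
  qed
  obtain c where c: "AE x in leb. W x = c + integral {-1..x} g"
    using W_absolutely_continuous by blast
  have "g \<in> L2_space ivl"
  proof -
    have "(\<lambda>x. m x * (if s x = 0 then 1 else 0)) \<in> L2_space ivl"
    proof (rule L2_bounded_mult[OF m, of _ 1])
      have [measurable]: "s \<in> borel_measurable leb" by (rule s_measurable)
      show "(\<lambda>x. if s x = 0 then 1 else 0) \<in> borel_measurable leb" by measurable
    qed auto
    moreover have "g = (\<lambda>x. m x * (if s x = 0 then 1 else 0))" by (auto simp: g_def)
    ultimately show ?thesis by simp
  qed
  then have "has_weak_deriv 1 ivl W g"
    by (rule has_weak_deriv_primitive[OF _ L2_measurable[OF W] c])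
  then show ?thesis by blast
qed

theorem corollary2p2:
  fixes I :: "real set" and \<beta> :: real and y_d f \<psi> ybar ubar :: "real \<Rightarrow> real"
  assumes "I = {-1<..<1}"
    and "\<beta> > 0"
    and "y_d \<in> L2_space I"
    and "f \<in> Sobolev_space 1 I"
    and "\<psi> \<in> Sobolev_space 2 I"
    and "(LINT x|lebesgue_on I. \<psi> x) > 0"
    and "is_arg_min (cost I \<beta> y_d) (\<lambda>p. p \<in> admissible I f \<psi>) (ybar, ubar)"
  shows "(ybar, ubar) \<in> Sobolev_space 3 I \<times> Sobolev_space 1 I"
proof -
  note opt = assms(7)[unfolded assms(1)]
  obtain f1 where df: "has_weak_deriv 1 ivl f f1" using assms(1,4) Sobolev_1_iff by auto
  have "\<forall>j\<le>2. \<exists>g. has_weak_deriv j ivl \<psi> g"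
    using assms(1,5) by (simp add: Sobolev_space_def)
  then obtain \<psi>1 \<psi>2 where d\<psi>: "has_weak_deriv 1 ivl \<psi> \<psi>1" and "has_weak_deriv 2 ivl \<psi> \<psi>2"
    by (meson one_le_numeral order_refl)
  then have d\<psi>1: "has_weak_deriv 1 ivl \<psi>1 \<psi>2" by (intro has_weak_deriv_2D[OF d\<psi>])
  have f: "f \<in> L2_space ivl" by (rule has_weak_deriv_L2(1)[OF df])
  have yd: "y_d \<in> L2_space ivl" using assms(1,3) by simp
  have adm: "(ybar, ubar) \<in> admissible ivl f \<psi>" using opt by (simp add: is_arg_min_def)
  then have y: "ybar \<in> H10_space ivl" and u: "ubar \<in> L2_space ivl"
    and le: "AE x in leb. weak_deriv ivl ybar x \<le> \<psi> x" by (auto simp: admissible_def)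
  define p where "p = weak_deriv ivl ybar"
  have dy: "has_weak_deriv 1 ivl ybar p" unfolding p_def by (rule H10_has_weak_deriv[OF y])
  have dp: "has_weak_deriv 1 ivl p (\<lambda>x. - (ubar x + f x))"
    unfolding p_def by (rule admissible_second_weak_deriv[OF adm f])
  have mean: "(LINT x|leb. p x) < (LINT x|leb. \<psi> x)"
    using H10_integral_weak_deriv[OF y] assms(1,6) by (simp add: p_def)
  obtain s where s_cont: "continuous_on {-1..1} s" and s_ae: "AE x in leb. \<psi> x - p x = s x"
    and s_nonneg: "\<And>x. x \<in> ivl \<Longrightarrow> 0 \<le> s x" and s_pos: "\<exists>x\<in>ivl. s x > 0"
    and s_diff: "\<And>x z. -1 < x \<Longrightarrow> x \<le> z \<Longrightarrow> z < 1 \<Longrightarrow>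
      s z - s x = integral {x..z} (\<lambda>t. \<psi>1 t - - (ubar t + f t))"
    using gap_of_minimizer[OF d\<psi> dp le[folded p_def] mean] by blast
  define h where "h x = ybar x - y_d x" for x
  define H where "H x = integral {-1..x} h" for x
  define H0 where "H0 x = integral {-1..x} H" for x
  have h: "h \<in> L2_space ivl"
    unfolding h_def[abs_def] by (rule L2_diff[OF has_weak_deriv_L2(1)[OF dy] yd])
  have dH: "has_weak_deriv 1 ivl H h"
    unfolding H_def[abs_def] by (rule has_weak_deriv_primitive_self[OF h])
  have dH0: "has_weak_deriv 1 ivl H0 H"
    unfolding H0_def[abs_def] by (rule has_weak_deriv_primitive_self[OF has_weak_deriv_L2(1)[OF dH]])
  \<comment> \<open>The function that the variational inequality tests with \<open>V'\<close>.\<close>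
  define W0 where "W0 x = H0 x - \<beta> * ubar x" for x
  have W0: "W0 \<in> L2_space ivl"
    using L2_comb[OF has_weak_deriv_L2(1)[OF dH0] u, of 1 "-\<beta>"] by (simp add: W0_def[abs_def])
  have s_cont': "continuous_on ivl s" by (rule continuous_on_subset[OF s_cont]) auto
  obtain x0 where x0: "x0 \<in> ivl" "s x0 > 0" using s_pos by blast
  have var: "0 \<le> (LINT x|leb. W0 x * deriv V x)"
    if "V \<in> test_functions ivl" "(LINT x|leb. V x) = 0" "\<delta> > 0" "\<And>x. x \<in> ivl \<Longrightarrow> V x > 0 \<Longrightarrow> \<delta> \<le> s x" for V \<delta>
    using variational_inequality[OF opt assms(2) f yd s_ae[unfolded p_def] s_nonneg that]
    by (simp add: W0_def H0_def[abs_def] H_def[abs_def] h_def[abs_def])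
  have "\<exists>l. (\<forall>\<phi>\<in>test_functions ivl. (\<forall>x\<in>ivl. 0 \<le> \<phi> x) \<longrightarrow>
        (LINT x|leb. (W0 x - l * x) * deriv \<phi> x) \<le> 0) \<and>
      (\<forall>\<phi>\<in>test_functions ivl. \<forall>\<delta>>0. (\<forall>x\<in>ivl. 0 \<le> \<phi> x \<and> (\<phi> x > 0 \<longrightarrow> \<delta> \<le> s x)) \<longrightarrow>
        0 \<le> (LINT x|leb. (W0 x - l * x) * deriv \<phi> x))"
    by (rule multiplier[OF L2_integrable[OF W0] x0 s_cont']) (rule var)
  then obtain l where
    l_le: "\<forall>\<phi>\<in>test_functions ivl. (\<forall>x\<in>ivl. 0 \<le> \<phi> x) \<longrightarrow>
      (LINT x|leb. (W0 x - l * x) * deriv \<phi> x) \<le> 0" and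
    l_ge: "\<forall>\<phi>\<in>test_functions ivl. \<forall>\<delta>>0. (\<forall>x\<in>ivl. 0 \<le> \<phi> x \<and> (\<phi> x > 0 \<longrightarrow> \<delta> \<le> s x)) \<longrightarrow>
      0 \<le> (LINT x|leb. (W0 x - l * x) * deriv \<phi> x)"
    by (elim exE conjE)
  define W where "W x = W0 x - l * x" for x
  have dx: "has_weak_deriv 1 ivl (\<lambda>x. x) (\<lambda>x. 1)" by (rule has_weak_deriv_id)
  have W: "W \<in> L2_space ivl"
    using L2_comb[OF W0 has_weak_deriv_L2(1)[OF dx], of 1 "-l"] by (simp add: W_def[abs_def])
  \<comment> \<open>The function \<open>\<beta> (\<psi>' + f) + H\<^sub>0 - l x\<close>, written with nested linear combinations so that its weak
  derivative can be read off.\<close>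
  define R where "R x = 1 * (\<beta> * \<psi>1 x + \<beta> * f x) + 1 * (1 * H0 x + (-l) * x)" for x
  define m where "m x = 1 * (\<beta> * \<psi>2 x + \<beta> * f1 x) + 1 * (1 * H x + (-l) * 1)" for x
  have dR: "has_weak_deriv 1 ivl R m"
    unfolding R_def[abs_def] m_def[abs_def] by (intro has_weak_deriv_comb d\<psi>1 df dH0 dx)
  have "\<exists>g. has_weak_deriv 1 ivl W g"
  proof (rule obstacle_multiplier_regularity[OF W dR])
    show "continuous_on ivl (\<lambda>x. \<beta> * s x)" by (intro continuous_intros s_cont')
    show "0 \<le> \<beta> * s x" if "x \<in> ivl" for x using s_nonneg[OF that] assms(2) by simp
    show "\<beta> * s z - \<beta> * s x = integral {x..z} (\<lambda>t. R t - W t)" if xz: "-1 < x" "x \<le> z" "z < 1" for x z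
    proof -
      have "R t - W t = \<beta> * (\<psi>1 t - - (ubar t + f t))" for t
        by (simp add: R_def W_def W0_def algebra_simps)
      then show ?thesis using s_diff[OF xz] by (simp add: right_diff_distrib[symmetric])
    qed
    show "(LINT x|leb. W x * deriv \<phi> x) \<le> 0"
      if "\<phi> \<in> test_functions ivl" "\<And>x. x \<in> ivl \<Longrightarrow> 0 \<le> \<phi> x" for \<phi>
      unfolding W_def by (rule l_le[rule_format, OF that])
    show "0 \<le> (LINT x|leb. W x * deriv \<phi> x)"
      if \<phi>: "\<phi> \<in> test_functions ivl" and \<delta>: "\<delta> > 0"
        and s: "\<And>x. x \<in> ivl \<Longrightarrow> 0 \<le> \<phi> x \<and> (\<phi> x > 0 \<longrightarrow> \<delta> \<le> \<beta> * s x)" for \<phi> \<delta>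
      unfolding W_def
    proof (rule l_ge[rule_format, OF \<phi>])
      show "\<delta> / \<beta> > 0" using \<delta> assms(2) by simp
      show "0 \<le> \<phi> x \<and> (\<phi> x > 0 \<longrightarrow> \<delta> / \<beta> \<le> s x)" if "x \<in> ivl" for x
        using s[OF that] assms(2) by (simp add: field_simps)
    qed
  qed
  then obtain g where dW: "has_weak_deriv 1 ivl W g" by blast
  \<comment> \<open>Solve the definition of \<open>W\<close> for the control.\<close>
  have "has_weak_deriv 1 ivl (\<lambda>x. 1 / \<beta> * (1 * H0 x + (-l) * x) + (- 1 / \<beta>) * W x)
      (\<lambda>x. 1 / \<beta> * (1 * H x + (-l) * 1) + (- 1 / \<beta>) * g x)"
    by (intro has_weak_deriv_comb dH0 dx dW)
  moreover have "(\<lambda>x. 1 / \<beta> * (1 * H0 x + (-l) * x) + (- 1 / \<beta>) * W x) = ubar"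
    using assms(2) by (auto simp: W_def W0_def field_simps)
  ultimately obtain u1 where du: "has_weak_deriv 1 ivl ubar u1" by auto
  have "has_weak_deriv 1 ivl (\<lambda>x. - (ubar x + f x)) (\<lambda>x. - (u1 x + f1 x))"
    using has_weak_deriv_comb[OF du df, of "-1" "-1"] by simp
  then have "ybar \<in> Sobolev_space 3 ivl" by (rule Sobolev_3I[OF dy dp])
  moreover have "ubar \<in> Sobolev_space 1 ivl" using du Sobolev_1_iff by blast
  ultimately show ?thesis using assms(1) by simp
qed

end
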